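(* For every integer $d\ge 1$ let $O_d$ be the number of finite $O$-sequences of multiplicity $d$, and let $A_d$ be the number of finite $O$-sequences of multiplicity $d$ whose last non-zero value is strictly greater than $1$. Then: (1) $1<O_d/O_{d-1}\le 2$ and $O_d\le 2^{d-2}$, for every $d\ge 3$. (2) The sequence $(O_d/O_{d-1})_d$ converges to the real number $b$ if, and only if, the sequence $(A_d/O_{d-1})_d$ converges to the real number $\ell=b-1$. (3) If $(O_d/O_{d-1})_d$ converges to a real number $b$, then $b\le \frac{1+\sqrt5}{2}$ and, equivalently, $\ell\le\left(\frac{1+\sqrt5}{2}\right)^{-1}$, where $\ell$ is the limit of $(A_d/O_{d-1})_d$. (4) For every $d\ge 4$, $$\frac{A_d}{O_{d-1}}\le\frac{A_{d-1}}{O_{d-2}}+\frac{A_{d-2}}{O_{d-3}}\qquad\text{and}\qquad \frac{O_d}{O_{d-1}}\le\frac{O_{d-1}}{O_{d-2}}+\frac{O_{d-2}}{O_{d-3}}.$$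
   Context: Let $K$ be a field. For a homogeneous ideal $I$ of a standard graded polynomial ring $R=K[x_1,\dots,x_p]$, the Hilbert function of $R/I$ is $t\mapsto \dim_K R_t-\dim_K I_t$. An $O$-sequence is a numerical function $(a_0,a_1,\dots)$ that is the Hilbert function of some such $R/I$. A finite $O$-sequence is an $O$-sequence which is eventually zero (i.e. the Hilbert function of an Artinian quotient $R/I$), written $(a_0,a_1,\dots,a_s)$ with $a_s\neq 0$; its multiplicity is $\sum_{i=0}^s a_i$, and its last non-zero value is $a_s$. Equivalently (Macaulay), a finite sequence of positive integers $(a_0,\dots,a_s)$ is a finite $O$-sequence if and only if $a_0=1$ and $a_{t+1}\le a_t^{\langle t\rangle}$ for all $1\le t<s$. Here, for positive integers $a,t$ with binomial expansion $a=\binom{k(t)}{t}+\binom{k(t-1)}{t-1}+\dots+\binom{k(j)}{j}$, $k(t)>k(t-1)>\dots>k(j)\ge j\ge 1$ (such an expansion exists and is unique), one sets $a^{\langle t\rangle}=\binom{k(t)+1}{t+1}+\binom{k(t-1)+1}{t}+\dots+\binom{k(j)+1}{j+1}$. The sequences $(O_d/O_{d-1})_d$ and $(A_d/O_{d-1})_d$ are indexed by $d\ge 2$. *)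

theory Defs
  imports Complex_Main "HOL-Library.Poly_Mapping" "HOL-Algebra.Ideal"
begin

text \<open>
  Polynomials over \<open>'k\<close> are finitely supported functions from monomials (exponent vectors) to
  coefficients; the product of \<^typ>\<open>'a \<Rightarrow>\<^sub>0 'b\<close> is the convolution product.  The ambient type has
  infinitely many indeterminates, and \<open>K[x_1, ..., x_p]\<close> is the subring of those polynomials that
  involve only the indeterminates with index below \<open>p\<close>.
\<close>

type_synonym monomial = "nat \<Rightarrow>\<^sub>0 nat"

type_synonym 'k mpoly = "monomial \<Rightarrow>\<^sub>0 'k"

definition mon_degree :: "monomial \<Rightarrow> nat" where
  "mon_degree m = (\<Sum>i\<in>Poly_Mapping.keys m. Poly_Mapping.lookup m i)"

definition polys :: "nat \<Rightarrow> 'k::field mpoly set" where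
  "polys p = {f. \<forall>m\<in>Poly_Mapping.keys f. Poly_Mapping.keys m \<subseteq> {..<p}}"

definition poly_ring :: "nat \<Rightarrow> 'k::field mpoly ring" where
  "poly_ring p = \<lparr>carrier = polys p, mult = (*), one = 1, zero = 0, add = (+)\<rparr>"

lemma cring_poly_ring: "cring (poly_ring p :: 'k::field mpoly ring)"
proof (rule cringI)
  have add: "f + g \<in> polys p" and mul: "f * g \<in> polys p" and neg: "- f \<in> polys p"
    if "f \<in> polys p" "g \<in> polys p" for f g :: "'k mpoly"
  proof -
    show "f + g \<in> polys p"
      using that Poly_Mapping.keys_add[of f g] by (fastforce simp: polys_def)
    show "f * g \<in> polys p"
      unfolding polys_def
    proof (intro CollectI ballI)
      fix m assume "m \<in> Poly_Mapping.keys (f * g)"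
      then obtain a b where "m = a + b" "a \<in> Poly_Mapping.keys f" "b \<in> Poly_Mapping.keys g"
        using keys_mult[of f g] by blast
      then show "Poly_Mapping.keys m \<subseteq> {..<p}"
        using that Poly_Mapping.keys_add[of a b] by (fastforce simp: polys_def)
    qed
    show "- f \<in> polys p"
      using that by (simp add: polys_def)
  qed
  have zero: "0 \<in> (polys p :: 'k mpoly set)" and one: "1 \<in> (polys p :: 'k mpoly set)"
    by (simp_all add: polys_def)
  show "abelian_group (poly_ring p :: 'k mpoly ring)"
  proof (rule abelian_groupI)
    fix f :: "'k mpoly" assume "f \<in> carrier (poly_ring p)"
    then show "\<exists>g\<in>carrier (poly_ring p). g \<oplus>\<^bsub>poly_ring p\<^esub> f = \<zero>\<^bsub>poly_ring p\<^esub>"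
      by (intro bexI[of _ "- f"]) (auto simp: poly_ring_def neg)
  qed (auto simp: poly_ring_def add zero add.assoc add.commute)
  show "Group.comm_monoid (poly_ring p :: 'k mpoly ring)"
    by (rule comm_monoidI) (auto simp: poly_ring_def mul one mult.assoc mult.commute)
qed (simp add: poly_ring_def distrib_right)

definition scale_poly :: "'k::field \<Rightarrow> 'k mpoly \<Rightarrow> 'k mpoly" where
  "scale_poly c f = Poly_Mapping.map ((*) c) f"

definition homogeneous :: "nat \<Rightarrow> 'k::field mpoly set" where
  "homogeneous t = {f. \<forall>m\<in>Poly_Mapping.keys f. mon_degree m = t}"

definition hom_component :: "nat \<Rightarrow> 'k::field mpoly \<Rightarrow> 'k mpoly" where
  "hom_component t f = (\<Sum>m | m \<in> Poly_Mapping.keys f \<and> mon_degree m = t.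
     Poly_Mapping.single m (Poly_Mapping.lookup f m))"

definition homogeneous_ideal :: "nat \<Rightarrow> 'k::field mpoly set \<Rightarrow> bool" where
  "homogeneous_ideal p I \<longleftrightarrow>
     ideal I (poly_ring p) \<and> (\<forall>f\<in>I. \<forall>t. hom_component t f \<in> I)"

interpretation polys_vs: vector_space "scale_poly :: 'k::field \<Rightarrow> 'k mpoly \<Rightarrow> 'k mpoly"
proof
  fix a b :: 'k and f g :: "'k mpoly"
  show "scale_poly a (f + g) = scale_poly a f + scale_poly a g"
    by (simp add: scale_poly_def mult_map_scale_conv_mult distrib_left)
  show "scale_poly (a + b) f = scale_poly a f + scale_poly b f"
    by (simp add: scale_poly_def mult_map_scale_conv_mult distrib_right single_add)
  show "scale_poly a (scale_poly b f) = scale_poly (a * b) f"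
    by (simp add: scale_poly_def mult_map_scale_conv_mult mult_single flip: mult.assoc)
  show "scale_poly 1 f = f"
    by (simp add: scale_poly_def mult_map_scale_conv_mult)
qed

text \<open>
  The subtraction is that of \<^typ>\<open>nat\<close>; it does not truncate, because the second space is
  contained in the first, which has finite dimension.
\<close>

definition hilbert_function :: "nat \<Rightarrow> 'k::field mpoly set \<Rightarrow> nat \<Rightarrow> nat" where
  "hilbert_function p I t =
     polys_vs.dim (polys p \<inter> homogeneous t :: 'k mpoly set) - polys_vs.dim (I \<inter> homogeneous t)"

text \<open>The argument of type \<^typ>\<open>'k itself\<close> records the ground field.\<close>

definition O_sequence :: "'k::field itself \<Rightarrow> (nat \<Rightarrow> nat) \<Rightarrow> bool" where
  "O_sequence K a \<longleftrightarrow>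
     (\<exists>p. \<exists>I :: 'k mpoly set. homogeneous_ideal p I \<and> a = hilbert_function p I)"

text \<open>
  A finite \<open>O\<close>-sequence \<open>(a_0, ..., a_s)\<close> is represented by its extension by zero.
  The condition \<^prop>\<open>a s \<noteq> 0\<close> excludes the zero function, the Hilbert function of the zero ring.
\<close>

definition finite_O_sequence :: "'k::field itself \<Rightarrow> (nat \<Rightarrow> nat) \<Rightarrow> bool" where
  "finite_O_sequence K a \<longleftrightarrow> O_sequence K a \<and> (\<exists>s. a s \<noteq> 0 \<and> (\<forall>t>s. a t = 0))"

definition last_index :: "(nat \<Rightarrow> nat) \<Rightarrow> nat" where
  "last_index a = (THE s. a s \<noteq> 0 \<and> (\<forall>t>s. a t = 0))"

definition seq_multiplicity :: "(nat \<Rightarrow> nat) \<Rightarrow> nat" where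
  "seq_multiplicity a = (\<Sum>i\<le>last_index a. a i)"

definition O_num :: "'k::field itself \<Rightarrow> nat \<Rightarrow> nat" where
  "O_num K d = card {a. finite_O_sequence K a \<and> seq_multiplicity a = d}"

definition A_num :: "'k::field itself \<Rightarrow> nat \<Rightarrow> nat" where
  "A_num K d =
     card {a. finite_O_sequence K a \<and> seq_multiplicity a = d \<and> a (last_index a) > 1}"

text \<open>
  Only the values at \<open>d \<ge> 2\<close> of the following two sequences are meaningful; the values at \<open>0\<close>
  and \<open>1\<close> are artefacts of totality and do not influence limits.
\<close>

definition O_ratio :: "'k::field itself \<Rightarrow> nat \<Rightarrow> real" where
  "O_ratio K d = real (O_num K d) / real (O_num K (d - 1))"

definition A_ratio :: "'k::field itself \<Rightarrow> nat \<Rightarrow> real" where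
  "A_ratio K d = real (A_num K d) / real (O_num K (d - 1))"

end

theory Submission
  imports Defs
begin

text \<open>
  Passing to the complement of the leading monomials of an ideal, the finite \<open>O\<close>-sequences are exactly
  the rank functions of the finite nonempty sets of monomials closed under divisors, over any field.
  If \<open>(a_0, ..., a_s)\<close> is such a rank function, then removing monomials of top degree shows that its
  last value may be lowered or dropped. Its last value may also be followed by \<open>1\<close>: compressing
  with respect to the pairs of variables \<open>x_0, x_i\<close> one obtains a set with the same rank function
  that contains \<open>x_0^s\<close>, to which \<open>x_0^(s+1)\<close> can be added. Finally a value \<open>1\<close> in positive degree is
  followed by a value at most \<open>1\<close>, because all divisors of degree \<open>t\<close> of a monomial of degree \<open>t + 1\<close>
  coincide only if that monomial is a pure power.

  Appending \<open>1\<close> gives \<open>O_d = O_(d-1) + A_d\<close>. Lowering a last value above \<open>1\<close> gives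
  \<open>A_d \<le> O_(d-1)\<close>, and, if last values equal to \<open>2\<close> are dropped instead, \<open>A_d \<le> A_(d-1) + A_(d-2)\<close>.
  All the claims follow from these three relations.
\<close>

section \<open>Monomials and leading monomials\<close>

lemma mon_degree_superset:
  assumes "finite S" "Poly_Mapping.keys m \<subseteq> S"
  shows "mon_degree m = (\<Sum>i\<in>S. Poly_Mapping.lookup m i)"
  unfolding mon_degree_def
  by (rule sum.mono_neutral_left) (use assms in \<open>auto simp: in_keys_iff\<close>)

lemma keys_add_monomial:
  "Poly_Mapping.keys (m + n :: monomial) = Poly_Mapping.keys m \<union> Poly_Mapping.keys n"
  by (auto simp: in_keys_iff lookup_add)

lemma mon_degree_add: "mon_degree (m + n) = mon_degree m + mon_degree n"
proof -
  let ?S = "Poly_Mapping.keys m \<union> Poly_Mapping.keys n"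
  have "mon_degree k = (\<Sum>i\<in>?S. Poly_Mapping.lookup k i)" if "k \<in> {m, n, m + n}" for k
    by (rule mon_degree_superset) (use that in \<open>auto simp: keys_add_monomial\<close>)
  then show ?thesis
    by (simp add: lookup_add sum.distrib)
qed

lemma mon_degree_zero [simp]: "mon_degree 0 = 0"
  by (simp add: mon_degree_def)

lemma mon_degree_single [simp]: "mon_degree (Poly_Mapping.single i a) = a"
  by (cases "a = 0") (simp_all add: mon_degree_def)

definition monomials :: "nat \<Rightarrow> nat \<Rightarrow> monomial set" where
  "monomials p t = {m. Poly_Mapping.keys m \<subseteq> {..<p} \<and> mon_degree m = t}"

lemma lookup_le_mon_degree: "Poly_Mapping.lookup m i \<le> mon_degree m"
proof (cases "i \<in> Poly_Mapping.keys m")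
  case True
  then show ?thesis
    unfolding mon_degree_def by (intro member_le_sum) auto
qed (simp add: in_keys_iff)

lemma mon_degree_eq_0_iff [simp]: "mon_degree m = 0 \<longleftrightarrow> m = 0"
proof
  assume "mon_degree m = 0"
  then show "m = 0"
    using lookup_le_mon_degree[of m] by (intro poly_mapping_eqI) simp
qed simp

lemma finite_monomials: "finite (monomials p t)"
proof (rule finite_imageD)
  have "Poly_Mapping.lookup ` monomials p t
      \<subseteq> {f. \<forall>i. (i \<in> {..<p} \<longrightarrow> f i \<in> {..t}) \<and> (i \<notin> {..<p} \<longrightarrow> f i = 0)}"
    by (auto simp: monomials_def lookup_le_mon_degree simp flip: not_in_keys_iff_lookup_eq_zero)
  then show "finite (Poly_Mapping.lookup ` monomials p t)"
    by (rule finite_subset) (intro finite_set_of_finite_funs finite_lessThan finite_atMost)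
  show "inj_on Poly_Mapping.lookup (monomials p t)"
    by (intro inj_onI poly_mapping_eq_iff[THEN iffD2])
qed

section \<open>Leading monomials and dimensions of spaces of polynomials\<close>

lemma lookup_scale_poly: "Poly_Mapping.lookup (scale_poly c f) m = c * Poly_Mapping.lookup f m"
  by (simp add: scale_poly_def Poly_Mapping.map.rep_eq when_def)

text \<open>The maximum refers to the lexicographic order carried by the type of finitely supported
  functions; it is linear and compatible with addition. At \<open>0\<close> the value is an
  unspecified \<open>Max {}\<close>, so \<open>leading_monomials\<close> leaves \<open>0\<close>
  out.\<close>

definition leading_monomial :: "'k::field mpoly \<Rightarrow> monomial" where
  "leading_monomial f = Max (Poly_Mapping.keys f)"

definition leading_monomials :: "'k::field mpoly set \<Rightarrow> monomial set" where
  "leading_monomials V = leading_monomial ` (V - {0})"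

lemma leading_monomial_in_keys: "f \<noteq> 0 \<Longrightarrow> leading_monomial f \<in> Poly_Mapping.keys f"
  by (simp add: leading_monomial_def)

lemma lookup_above_leading_monomial: "leading_monomial f < m \<Longrightarrow> Poly_Mapping.lookup f m = 0"
  unfolding leading_monomial_def by (metis Max_ge finite_keys in_keys_iff leD)

text \<open>With infinitely many indeterminates the lexicographic order has infinite descending
  chains (\<open>x_0 > x_1 > ...\<close>). The division argument below therefore descends along the
  number of elements of a finite set \<open>T\<close> below the leading monomial.\<close>

lemma card_down_set_less:
  fixes T :: "'a::linorder set"
  assumes "finite T" "x \<in> T" "y < x"
  shows "card {z \<in> T. z \<le> y} < card {z \<in> T. z \<le> x}"
proof (rule psubset_card_mono)
  have "x \<notin> {z \<in> T. z \<le> y}" "x \<in> {z \<in> T. z \<le> x}"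
    using assms(2,3) by simp_all
  moreover have "{z \<in> T. z \<le> y} \<subseteq> {z \<in> T. z \<le> x}"
    using assms(3) by (auto intro: order.trans less_imp_le)
  ultimately show "{z \<in> T. z \<le> y} \<subset> {z \<in> T. z \<le> x}"
    by blast
qed (use assms(1) in simp)

text \<open>One element of \<open>V\<close> chosen for each leading monomial gives a basis: in a
  linear relation the largest leading monomial cannot cancel, and subtracting multiples of the
  chosen elements reduces every element of \<open>V\<close> to \<open>0\<close>.\<close>

lemma dim_eq_card_leading_monomials:
  fixes V :: "'k::field mpoly set"
  assumes V: "polys_vs.subspace V" and T: "finite T" "\<And>f. f \<in> V \<Longrightarrow> Poly_Mapping.keys f \<subseteq> T"
  shows "polys_vs.dim V = card (leading_monomials V)"
proof -
  define L where "L = leading_monomials V"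
  have "\<forall>m\<in>L. \<exists>f. f \<in> V \<and> f \<noteq> 0 \<and> leading_monomial f = m"
    by (auto simp: L_def leading_monomials_def)
  then obtain g where g: "\<And>m. m \<in> L \<Longrightarrow> g m \<in> V \<and> g m \<noteq> 0 \<and> leading_monomial (g m) = m"
    by metis
  have L_sub: "L \<subseteq> T"
    using T(2) leading_monomial_in_keys by (fastforce simp: L_def leading_monomials_def)
  then have finL: "finite L"
    using T(1) finite_subset by blast
  have inj: "inj_on g L"
    by (metis g inj_onI)
  have "polys_vs.independent (g ` L)"
  proof (rule polys_vs.independent_if_scalars_zero)
    show "finite (g ` L)"
      using finL by simp
    fix c :: "'k mpoly \<Rightarrow> 'k" and x
    assume sum0: "(\<Sum>x\<in>g ` L. scale_poly (c x) x) = 0" and x: "x \<in> g ` L"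
    show "c x = 0"
    proof (rule ccontr)
      assume "c x \<noteq> 0"
      \<comment> \<open>\<open>m\<close> is the largest leading monomial that enters the relation
        with a nonzero coefficient; only the summand of \<open>g m\<close> contributes to the
        coefficient at \<open>m\<close>.\<close>
      define S where "S = {m \<in> L. c (g m) \<noteq> 0}"
      define m where "m = Max S"
      have S: "finite S" "S \<noteq> {}"
        using x \<open>c x \<noteq> 0\<close> finL by (auto simp: S_def)
      then have mS: "m \<in> S"
        by (simp add: m_def)
      then have mL: "m \<in> L" and cm: "c (g m) \<noteq> 0"
        by (simp_all add: S_def)
      have zero: "c (g n) * Poly_Mapping.lookup (g n) m = 0" if "n \<in> L - {m}" for n
      proof (cases "n \<in> S")
        case True
        then have "n < m"
          using S(1) that by (simp add: m_def order_less_le)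
        then show ?thesis
          using g[of n] that lookup_above_leading_monomial[of "g n" m] by simp
      qed (use that in \<open>simp add: S_def\<close>)
      have "Poly_Mapping.lookup (g m) m \<noteq> 0"
        using g[OF mL] leading_monomial_in_keys by (metis in_keys_iff)
      moreover have "(\<Sum>n\<in>L - {m}. c (g n) * Poly_Mapping.lookup (g n) m) = 0"
        by (rule sum.neutral) (use zero in blast)
      moreover have "(\<Sum>n\<in>L. c (g n) * Poly_Mapping.lookup (g n) m) = 0"
        using arg_cong[OF sum0, of "\<lambda>f. Poly_Mapping.lookup f m"]
        by (simp add: sum.reindex[OF inj] lookup_sum lookup_scale_poly)
      ultimately show False
        using cm by (simp add: sum.remove[OF finL mL])
    qed
  qed
  moreover have "f \<in> polys_vs.span (g ` L)" if "f \<in> V" for f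
    using that
  proof (induction "card {z \<in> T. f \<noteq> 0 \<and> z \<le> leading_monomial f}" arbitrary: f rule: less_induct)
    case less
    show ?case
    proof (cases "f = 0")
      case True
      then show ?thesis
        by (simp add: polys_vs.span_zero)
    next
      case False
      define m where "m = leading_monomial f"
      have mL: "m \<in> L"
        using False less.prems by (auto simp: m_def L_def leading_monomials_def)
      have gm: "g m \<in> V" "g m \<noteq> 0" "leading_monomial (g m) = m"
        using g[OF mL] by auto
      \<comment> \<open>One division step: this quotient cancels the coefficient at
        \<open>m\<close>, so all monomials of \<open>h\<close> lie strictly below
        \<open>m\<close>.\<close>
      define c where "c = Poly_Mapping.lookup f m / Poly_Mapping.lookup (g m) m"
      define h where "h = f - scale_poly c (g m)"
      have hV: "h \<in> V"
        unfolding h_def using V less.prems gm(1) by (simp add: polys_vs.subspace_diff polys_vs.subspace_scale)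
      have lh: "Poly_Mapping.lookup h n = 0" if "m \<le> n" for n
      proof (cases "n = m")
        case True
        then show ?thesis
          using gm leading_monomial_in_keys[of "g m"]
          by (simp add: h_def lookup_minus lookup_scale_poly c_def in_keys_iff)
      next
        case False
        then show ?thesis
          using that gm lookup_above_leading_monomial[of f n] lookup_above_leading_monomial[of "g m" n]
          by (simp add: h_def lookup_minus lookup_scale_poly m_def order_less_le)
      qed
      have "h \<in> polys_vs.span (g ` L)"
      proof (cases "h = 0")
        case True
        then show ?thesis
          by (simp add: polys_vs.span_zero)
      next
        case h0: False
        have "leading_monomial h < m"
          using leading_monomial_in_keys[OF h0] lh by (meson in_keys_iff linorder_not_le)
        then have "card {z \<in> T. z \<le> leading_monomial h} < card {z \<in> T. z \<le> m}"
          using card_down_set_less T(1) L_sub mL by blast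
        then show ?thesis
          using less.hyps[of h] hV h0 False by (simp add: m_def)
      qed
      then have "h + scale_poly c (g m) \<in> polys_vs.span (g ` L)"
        using mL by (intro polys_vs.span_add[OF _ polys_vs.span_scale[OF polys_vs.span_base]]) simp_all
      then show ?thesis
        by (simp add: h_def)
    qed
  qed
  moreover have "g ` L \<subseteq> V"
    using g by blast
  ultimately have "card (g ` L) = polys_vs.dim V"
    by (intro polys_vs.basis_card_eq_dim subsetI) blast+
  then show ?thesis
    using card_image[OF inj] by (simp add: L_def)
qed

lemma subspace_keys_subset: "polys_vs.subspace {f :: 'k::field mpoly. Poly_Mapping.keys f \<subseteq> T}"
proof (rule polys_vs.subspaceI)
  fix f g :: "'k mpoly" and c :: 'k
  assume f: "f \<in> {f. Poly_Mapping.keys f \<subseteq> T}"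
  then show "scale_poly c f \<in> {f. Poly_Mapping.keys f \<subseteq> T}"
    by (auto simp: in_keys_iff lookup_scale_poly)
  assume "g \<in> {f. Poly_Mapping.keys f \<subseteq> T}"
  then show "f + g \<in> {f. Poly_Mapping.keys f \<subseteq> T}"
    using f Poly_Mapping.keys_add[of f g] by auto
qed simp

lemma dim_keys_subset:
  assumes "finite T"
  shows "polys_vs.dim {f :: 'k::field mpoly. Poly_Mapping.keys f \<subseteq> T} = card T"
proof -
  have "leading_monomials {f :: 'k mpoly. Poly_Mapping.keys f \<subseteq> T} = T"
  proof (intro equalityI subsetI)
    fix m assume "m \<in> T"
    then show "m \<in> leading_monomials {f :: 'k mpoly. Poly_Mapping.keys f \<subseteq> T}"
      unfolding leading_monomials_def
      by (intro image_eqI[of _ _ "Poly_Mapping.single m 1"]) (auto simp: leading_monomial_def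
          simp flip: keys_eq_empty)
  qed (use leading_monomial_in_keys in \<open>fastforce simp: leading_monomials_def\<close>)
  then show ?thesis
    using dim_eq_card_leading_monomials[OF subspace_keys_subset assms, of T] by (metis mem_Collect_eq)
qed

lemma polys_homogeneous: "polys p \<inter> homogeneous t = {f. Poly_Mapping.keys f \<subseteq> monomials p t}"
  by (auto simp: polys_def homogeneous_def monomials_def)

lemma lookup_hom_component:
  "Poly_Mapping.lookup (hom_component t f) m = (if mon_degree m = t then Poly_Mapping.lookup f m else 0)"
proof -
  have "Poly_Mapping.lookup (hom_component t f) m =
      (\<Sum>n | n \<in> Poly_Mapping.keys f \<and> mon_degree n = t. if n = m then Poly_Mapping.lookup f n else 0)"
    by (simp add: hom_component_def lookup_sum lookup_single when_def)
  also have "\<dots> = (if mon_degree m = t then Poly_Mapping.lookup f m else 0)"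
    by (simp add: sum.delta in_keys_iff)
  finally show ?thesis .
qed

text \<open>Translation by \<open>b\<close> is injective on monomials, so no terms merge or
  cancel.\<close>

lemma keys_times_single:
  "Poly_Mapping.keys (f * Poly_Mapping.single b 1 :: 'k::field mpoly) = (\<lambda>a. a + b) ` Poly_Mapping.keys f"
proof -
  have "f = (\<Sum>a\<in>Poly_Mapping.keys f. Poly_Mapping.single a (Poly_Mapping.lookup f a))"
    by (rule poly_mapping_eqI) (simp add: lookup_sum lookup_single when_def sum.delta in_keys_iff)
  then have "f * Poly_Mapping.single b 1 =
      (\<Sum>a\<in>Poly_Mapping.keys f. Poly_Mapping.single a (Poly_Mapping.lookup f a)) * Poly_Mapping.single b 1"
    by (rule arg_cong)
  also have "\<dots> = (\<Sum>a\<in>Poly_Mapping.keys f. Poly_Mapping.single (a + b) (Poly_Mapping.lookup f a))"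
    by (simp add: sum_distrib_right mult_single)
  finally have "Poly_Mapping.lookup (f * Poly_Mapping.single b 1) m =
      (\<Sum>a\<in>Poly_Mapping.keys f. if a + b = m then Poly_Mapping.lookup f a else 0)" for m
    by (simp add: lookup_sum lookup_single when_def)
  then have eq: "Poly_Mapping.lookup (f * Poly_Mapping.single b 1) (a + b) = Poly_Mapping.lookup f a" for a
    by (simp add: sum.delta in_keys_iff)
  show ?thesis
    using keys_mult[of f "Poly_Mapping.single b 1"] eq
    by (auto simp: in_keys_iff image_def)
qed

text \<open>Translation is monotone for the monomial order, hence commutes with
  \<open>Max\<close>.\<close>

lemma leading_monomial_times_single:
  assumes "f \<noteq> 0"
  shows "leading_monomial (f * Poly_Mapping.single b 1) = leading_monomial f + b"
  unfolding leading_monomial_def keys_times_single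
  using assms
  by (intro mono_Max_commute[symmetric]) (auto intro!: monoI add_right_mono)

section \<open>Order ideals of monomials\<close>

text \<open>Monomials are written additively: \<open>m\<close> divides \<open>m + n\<close>.\<close>

definition order_ideal :: "monomial set \<Rightarrow> bool" where
  "order_ideal M \<longleftrightarrow> (\<forall>m n. m + n \<in> M \<longrightarrow> m \<in> M)"

lemma order_idealD: "order_ideal M \<Longrightarrow> m + n \<in> M \<Longrightarrow> m \<in> M"
  unfolding order_ideal_def by blast

definition rank_function :: "monomial set \<Rightarrow> nat \<Rightarrow> nat" where
  "rank_function M t = card {m \<in> M. mon_degree m = t}"

text \<open>\<open>M\<close> consists of the standard monomials: those that are not the leading
  monomial of a form of the same degree in \<open>I\<close>. Multiplying such a form by a monomial
  translates its leading monomial, so the complement is closed under divisors; counting leading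
  monomials gives the dimensions.\<close>

lemma order_ideal_of_ideal:
  fixes I :: "'k::field mpoly set"
  assumes "ideal I (poly_ring p)"
  obtains M where "order_ideal M" "\<And>m. m \<in> M \<Longrightarrow> Poly_Mapping.keys m \<subseteq> {..<p}"
    "rank_function M = hilbert_function p I"
proof
  interpret ideal I "poly_ring p :: 'k mpoly ring"
    by fact
  have I_sub: "I \<subseteq> polys p"
    using a_subset by (simp add: poly_ring_def)
  have I_mult: "f * g \<in> I" if "f \<in> I" "g \<in> polys p" for f g
    using I_r_closed[of f g] that by (simp add: poly_ring_def)
  define L where "L t = leading_monomials (I \<inter> homogeneous t)" for t
  define M where "M = {m. Poly_Mapping.keys m \<subseteq> {..<p} \<and> m \<notin> L (mon_degree m)}"
  show "order_ideal M"
    unfolding order_ideal_def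
  proof (intro allI impI)
    fix m n assume mn: "m + n \<in> M"
    have "m \<notin> L (mon_degree m)"
    proof
      assume "m \<in> L (mon_degree m)"
      then obtain f where f: "f \<in> I" "f \<in> homogeneous (mon_degree m)" "f \<noteq> 0" "m = leading_monomial f"
        by (auto simp: L_def leading_monomials_def)
      let ?g = "f * Poly_Mapping.single n 1"
      have keys_g: "Poly_Mapping.keys ?g = (\<lambda>a. a + n) ` Poly_Mapping.keys f"
        by (rule keys_times_single)
      have "?g \<in> I"
        using f(1) mn by (intro I_mult) (auto simp: polys_def M_def keys_add_monomial)
      moreover have "?g \<in> homogeneous (mon_degree (m + n))"
        using f(2) by (auto simp: homogeneous_def keys_g mon_degree_add)
      moreover have "?g \<noteq> 0"
        using f(3) by (simp flip: keys_eq_empty add: keys_g)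
      ultimately have "leading_monomial ?g \<in> L (mon_degree (m + n))"
        by (auto simp: L_def leading_monomials_def)
      then show False
        using mn by (simp add: leading_monomial_times_single f(3) M_def flip: f(4))
    qed
    then show "m \<in> M"
      using mn by (simp add: M_def keys_add_monomial)
  qed
  show "Poly_Mapping.keys m \<subseteq> {..<p}" if "m \<in> M" for m
    using that by (simp add: M_def)
  show "rank_function M = hilbert_function p I"
  proof
    fix t
    have keys: "Poly_Mapping.keys f \<subseteq> monomials p t" if "f \<in> I \<inter> homogeneous t" for f
      using that I_sub polys_homogeneous[of p t] by blast
    \<comment> \<open>A scalar multiple is a product with a constant polynomial, so the ideal is a
      subspace.\<close>
    have "scale_poly c f \<in> I" if "f \<in> I" for c f
      using I_mult[OF that, of "Poly_Mapping.single 0 c"]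
      by (simp add: scale_poly_def mult_map_scale_conv_mult mult.commute polys_def)
    moreover have "f + g \<in> I" if "f \<in> I" "g \<in> I" for f g
      using additive_subgroup.a_closed[OF is_additive_subgroup that] by (simp add: poly_ring_def)
    moreover have "0 \<in> I"
      using additive_subgroup.zero_closed[OF is_additive_subgroup] by (simp add: poly_ring_def)
    ultimately have subI: "polys_vs.subspace I"
      by (simp add: polys_vs.subspace_def)
    have sub: "polys_vs.subspace (I \<inter> homogeneous t)"
      using polys_vs.subspace_inter[OF subI subspace_keys_subset[of "{m. mon_degree m = t}"]]
      by (simp add: homogeneous_def subset_eq)
    have L: "L t \<subseteq> monomials p t"
      using keys leading_monomial_in_keys by (fastforce simp: L_def leading_monomials_def)
    have "{m \<in> M. mon_degree m = t} = monomials p t - L t"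
      by (auto simp: M_def monomials_def)
    then have "rank_function M t = card (monomials p t) - card (L t)"
      using L finite_monomials by (simp add: rank_function_def card_Diff_subset finite_subset)
    also have "\<dots> = hilbert_function p I t"
      using dim_eq_card_leading_monomials[OF sub finite_monomials keys]
      by (simp add: hilbert_function_def polys_homogeneous dim_keys_subset finite_monomials L_def)
    finally show "rank_function M t = hilbert_function p I t" .
  qed
qed

text \<open>The ideal is the monomial ideal spanned by the monomials outside \<open>M\<close>. It
  absorbs products because a multiple of a monomial outside \<open>M\<close> is again outside
  \<open>M\<close>.\<close>

lemma ideal_of_order_ideal:
  assumes "order_ideal M" and keys_M: "\<And>m. m \<in> M \<Longrightarrow> Poly_Mapping.keys m \<subseteq> {..<p}"
  obtains I :: "'k::field mpoly set"
  where "homogeneous_ideal p I" "hilbert_function p I = rank_function M"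
proof
  define I :: "'k mpoly set" where "I = {f \<in> polys p. Poly_Mapping.keys f \<inter> M = {}}"
  interpret R: cring "poly_ring p :: 'k mpoly ring"
    by (rule cring_poly_ring)
  have mult: "f * g \<in> I" if f: "f \<in> I" and g: "g \<in> polys p" for f g
  proof -
    have "f * g \<in> polys p"
      using R.m_closed[of f g] f g by (simp add: poly_ring_def I_def)
    moreover have "m \<notin> M" if "m \<in> Poly_Mapping.keys (f * g)" for m
    proof -
      obtain a b where "m = a + b" "a \<in> Poly_Mapping.keys f"
        using keys_mult[of f g] \<open>m \<in> Poly_Mapping.keys (f * g)\<close> by blast
      then show ?thesis
        using f order_idealD[OF assms(1)] by (auto simp: I_def)
    qed
    ultimately show ?thesis
      by (auto simp: I_def)
  qed
  have "ideal I (poly_ring p)"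
  proof (rule idealI)
    show "subgroup I (add_monoid (poly_ring p))"
    proof (rule R.add.subgroupI)
      show "I \<subseteq> carrier (poly_ring p)"
        by (auto simp: I_def poly_ring_def)
      show "I \<noteq> {}"
        by (auto simp: I_def polys_def intro!: exI[of _ 0])
      fix f g assume f: "f \<in> I" and g: "g \<in> I"
      have "- f \<in> polys p" "f \<in> polys p"
        using f by (simp_all add: I_def polys_def)
      then have "\<ominus>\<^bsub>poly_ring p\<^esub> f = - f"
        by (intro R.add.inv_equality[unfolded a_inv_def[symmetric]]) (simp_all add: poly_ring_def)
      then show "\<ominus>\<^bsub>poly_ring p\<^esub> f \<in> I"
        using f by (simp add: I_def polys_def)
      have "f + g \<in> polys p"
        using R.a_closed[of f g] f g by (simp add: poly_ring_def I_def)
      then show "f \<oplus>\<^bsub>poly_ring p\<^esub> g \<in> I"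
        using f g Poly_Mapping.keys_add[of f g] by (auto simp: I_def poly_ring_def)
    qed
  next
    show "ring (poly_ring p :: 'k mpoly ring)"
      by (rule R.ring_axioms)
  next
    fix f g :: "'k mpoly" assume "f \<in> I" "g \<in> carrier (poly_ring p)"
    then show "g \<otimes>\<^bsub>poly_ring p\<^esub> f \<in> I" "f \<otimes>\<^bsub>poly_ring p\<^esub> g \<in> I"
      using mult[of f g] by (simp_all add: poly_ring_def mult.commute)
  qed
  moreover have "hom_component t f \<in> I" if "f \<in> I" for f t
  proof -
    have "Poly_Mapping.keys (hom_component t f) \<subseteq> Poly_Mapping.keys f"
      by (auto simp: in_keys_iff lookup_hom_component split: if_splits)
    then show ?thesis
      using that by (auto simp: I_def polys_def)
  qed
  ultimately show "homogeneous_ideal p I"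
    by (simp add: homogeneous_ideal_def)
  show "hilbert_function p I = rank_function M"
  proof
    fix t
    let ?M = "{m \<in> M. mon_degree m = t}"
    have "I \<inter> homogeneous t = {f. Poly_Mapping.keys f \<subseteq> monomials p t - ?M}"
      by (auto simp: I_def polys_def homogeneous_def monomials_def)
    moreover have "?M \<subseteq> monomials p t"
      using keys_M by (auto simp: monomials_def)
    ultimately show "hilbert_function p I t = rank_function M t"
      using finite_monomials[of p t] card_mono[of "monomials p t" ?M]
      by (simp add: hilbert_function_def polys_homogeneous dim_keys_subset rank_function_def
          card_Diff_subset finite_subset)
  qed
qed

text \<open>The right-hand side does not mention the field: from here on the argument is purely
  combinatorial. Finiteness of \<open>M\<close> comes from the vanishing of \<open>a\<close> beyond
  \<open>s\<close>, as each degree contains finitely many monomials in \<open>p\<close>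
  indeterminates. Conversely, \<open>p\<close> bounds the indices occurring in \<open>M\<close>, and
  the top degree of \<open>M\<close> serves as \<open>s\<close>.\<close>

lemma finite_O_sequence_iff:
  fixes K :: "'k::field itself"
  shows "finite_O_sequence K a \<longleftrightarrow>
    (\<exists>M. finite M \<and> M \<noteq> {} \<and> order_ideal M \<and> a = rank_function M)"
proof
  assume "finite_O_sequence K a"
  then obtain p and I :: "'k mpoly set" and s
    where I: "ideal I (poly_ring p)" and a: "a = hilbert_function p I"
      and s: "a s \<noteq> 0" "\<And>t. t > s \<Longrightarrow> a t = 0"
    unfolding finite_O_sequence_def O_sequence_def homogeneous_ideal_def by blast
  obtain M where M: "order_ideal M" "\<And>m. m \<in> M \<Longrightarrow> Poly_Mapping.keys m \<subseteq> {..<p}"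
    and a_eq: "rank_function M = hilbert_function p I"
    using order_ideal_of_ideal[OF I] by blast
  have fin: "finite {m \<in> M. mon_degree m = t}" for t
    by (rule finite_subset[OF _ finite_monomials[of p t]]) (use M(2) in \<open>auto simp: monomials_def\<close>)
  have "M \<noteq> {}"
    using s(1) by (auto simp: a simp flip: a_eq simp: rank_function_def)
  moreover have "M \<subseteq> (\<Union>t\<le>s. {m \<in> M. mon_degree m = t})"
  proof
    fix m assume m: "m \<in> M"
    then have "rank_function M (mon_degree m) \<noteq> 0"
      using fin by (auto simp: rank_function_def)
    then show "m \<in> (\<Union>t\<le>s. {m \<in> M. mon_degree m = t})"
      using m s(2)[of "mon_degree m"] a_eq a by fastforce
  qed
  then have "finite M"
    by (rule finite_subset) (use fin in simp)
  ultimately show "\<exists>M. finite M \<and> M \<noteq> {} \<and> order_ideal M \<and> a = rank_function M"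
    using M(1) a a_eq by (intro exI[of _ M]) simp
next
  assume "\<exists>M. finite M \<and> M \<noteq> {} \<and> order_ideal M \<and> a = rank_function M"
  then obtain M where M: "finite M" "M \<noteq> {}" "order_ideal M" and a: "a = rank_function M"
    by blast
  have "finite (\<Union>m\<in>M. Poly_Mapping.keys m)"
    using M(1) by simp
  then obtain p where "(\<Union>m\<in>M. Poly_Mapping.keys m) \<subseteq> {..<p}"
    unfolding finite_nat_set_iff_bounded by blast
  then obtain I :: "'k mpoly set" where "homogeneous_ideal p I" "hilbert_function p I = rank_function M"
    using ideal_of_order_ideal[OF M(3), of p] by blast
  then have "O_sequence K a"
    unfolding O_sequence_def a by metis
  moreover have "a (Max (mon_degree ` M)) \<noteq> 0"
  proof -
    have "Max (mon_degree ` M) \<in> mon_degree ` M"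
      using M(1,2) by (intro Max_in) simp_all
    then show ?thesis
      using M(1) by (auto simp: a rank_function_def)
  qed
  moreover have "a t = 0" if "t > Max (mon_degree ` M)" for t
  proof -
    have "{m \<in> M. mon_degree m = t} = {}"
      using M(1) that by (auto simp flip: not_le)
    then show ?thesis
      unfolding a rank_function_def by (simp only: card.empty)
  qed
  ultimately show "finite_O_sequence K a"
    unfolding finite_O_sequence_def by blast
qed

section \<open>Elementary properties of order ideals and their rank functions\<close>

lemma order_ideal_zero: "order_ideal M \<Longrightarrow> M \<noteq> {} \<Longrightarrow> 0 \<in> M"
  using order_idealD[of M 0] by auto

lemma monomial_split:
  assumes "i \<in> Poly_Mapping.keys m"
  obtains n where "m = n + Poly_Mapping.single i (1::nat)"
proof
  show "m = (m - Poly_Mapping.single i 1) + Poly_Mapping.single i 1"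
    by (rule poly_mapping_eqI)
      (use assms in \<open>auto simp: lookup_add lookup_minus lookup_single when_def in_keys_iff\<close>)
qed

lemma monomial_key:
  fixes m :: monomial
  assumes "m \<noteq> 0"
  obtains i where "i \<in> Poly_Mapping.keys m"
  using assms keys_eq_empty[of m] by blast

text \<open>Any division is a succession of divisions by single indeterminates; the induction is on
  the degree of the cofactor.\<close>

lemma order_idealI:
  assumes "\<And>m i. m + Poly_Mapping.single i 1 \<in> M \<Longrightarrow> m \<in> M"
  shows "order_ideal M"
proof -
  have "m \<in> M" if "m + n \<in> M" for m n
    using that
  proof (induction "mon_degree n" arbitrary: n)
    case (Suc d)
    then have "n \<noteq> 0"
      by force
    then obtain i where i: "i \<in> Poly_Mapping.keys n"
      by (rule monomial_key)
    then obtain n' where n: "n = n' + Poly_Mapping.single i 1"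
      by (rule monomial_split)
    then have "m + n' \<in> M"
      using Suc.prems assms by (metis add.assoc)
    then show ?case
      using Suc.hyps n by (simp add: mon_degree_add)
  qed simp
  then show ?thesis
    unfolding order_ideal_def by blast
qed

lemma rank_function_eq_0_iff: "finite M \<Longrightarrow> rank_function M t = 0 \<longleftrightarrow> (\<forall>m\<in>M. mon_degree m \<noteq> t)"
  by (auto simp: rank_function_def)

lemma rank_function_0:
  assumes "order_ideal M" "M \<noteq> {}"
  shows "rank_function M 0 = 1"
proof -
  have "{m \<in> M. mon_degree m = 0} = {0}"
    using order_ideal_zero[OF assms] by auto
  then show ?thesis
    by (simp add: rank_function_def)
qed

lemma rank_function_Suc_nonzero:
  assumes "finite M" "order_ideal M" "rank_function M (Suc t) \<noteq> 0"
  shows "rank_function M t \<noteq> 0"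
proof -
  obtain m where m: "m \<in> M" "mon_degree m = Suc t"
    using assms(1,3) by (auto simp: rank_function_eq_0_iff)
  then have "m \<noteq> 0"
    by force
  then obtain i where i: "i \<in> Poly_Mapping.keys m"
    by (rule monomial_key)
  then obtain n where n: "m = n + Poly_Mapping.single i 1"
    by (rule monomial_split)
  then have "n \<in> M" "mon_degree n = t"
    using m order_idealD[OF assms(2)] by (auto simp: mon_degree_add)
  then show ?thesis
    using assms(1) by (auto simp: rank_function_eq_0_iff)
qed

text \<open>If \<open>n\<close> is the only monomial of degree \<open>t\<close>, every
  \<open>m\<close> of degree \<open>t + 1\<close> is \<open>n x_i\<close> for each
  \<open>x_i\<close> dividing \<open>m\<close>. An indeterminate \<open>x_j\<close> dividing
  \<open>n\<close>, which exists because \<open>t > 0\<close>, also divides \<open>m\<close>, so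
  \<open>m = n x_j\<close> is determined.\<close>

lemma rank_function_Suc_le_1:
  assumes M: "finite M" "order_ideal M" and t: "rank_function M t = 1" "t > 0"
  shows "rank_function M (Suc t) \<le> 1"
proof -
  obtain n where n: "{m \<in> M. mon_degree m = t} = {n}"
    using t(1) by (auto simp: rank_function_def card_1_singleton_iff)
  have div: "m = n + Poly_Mapping.single i 1"
    if m: "m \<in> M" "mon_degree m = Suc t" and i: "i \<in> Poly_Mapping.keys m" for m i
  proof -
    from i obtain k where k: "m = k + Poly_Mapping.single i 1"
      by (rule monomial_split)
    then have "k \<in> {m \<in> M. mon_degree m = t}"
      using m order_idealD[OF M(2)] by (auto simp: mon_degree_add)
    then show ?thesis
      using n k by simp
  qed
  have "mon_degree n = t"
    using n by blast
  then have "n \<noteq> 0"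
    using t(2) by auto
  then obtain j where j: "j \<in> Poly_Mapping.keys n"
    by (rule monomial_key)
  have "m = n + Poly_Mapping.single j 1" if m: "m \<in> M" "mon_degree m = Suc t" for m
  proof -
    have "m \<noteq> 0"
      using m by force
    then obtain i where i: "i \<in> Poly_Mapping.keys m"
      by (rule monomial_key)
    have "m = n + Poly_Mapping.single i 1"
      by (rule div[OF m i])
    then have "j \<in> Poly_Mapping.keys m"
      using j by (simp add: keys_add_monomial)
    then show ?thesis
      by (rule div[OF m])
  qed
  then have "{m \<in> M. mon_degree m = Suc t} \<subseteq> {n + Poly_Mapping.single j 1}"
    by blast
  then have "card {m \<in> M. mon_degree m = Suc t} \<le> card {n + Poly_Mapping.single j (1::nat)}"
    by (rule card_mono[rotated]) simp
  then show ?thesis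
    by (simp add: rank_function_def)
qed

section \<open>Compression\<close>

text \<open>The case of two indeterminates, with \<open>b\<close> standing for
  \<open>x_0^(t+1-b) x_i^b\<close> in \<open>A\<close> and for \<open>x_0^(t-b) x_i^b\<close> in
  \<open>B\<close>. Dividing by \<open>x_0\<close> keeps \<open>b\<close>, dividing by
  \<open>x_i\<close> lowers it. Only the full set, of size \<open>t + 2\<close>, has fewer divisors
  of degree \<open>t\<close> than elements, which explains the minimum.\<close>

lemma card_shadow_ge:
  assumes A: "A \<subseteq> {..Suc t}" and B: "finite B"
    and "\<And>b. b \<in> A \<Longrightarrow> b \<le> t \<Longrightarrow> b \<in> B" "\<And>b. Suc b \<in> A \<Longrightarrow> b \<in> B"
  shows "min (card A) (Suc t) \<le> card B"
proof (cases "A = {..Suc t}")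
  case True
  then have "{..t} \<subseteq> B"
    using assms(3) by (meson atMost_iff le_SucI subsetI)
  then have "card {..t} \<le> card B"
    by (rule card_mono[OF B])
  then show ?thesis
    by (simp add: min.coboundedI2)
next
  case False
  then obtain j where j: "j \<notin> A" "j \<le> Suc t"
    using A by blast
  \<comment> \<open>\<open>A\<close> has a gap at \<open>j\<close>: the elements below it stay, those above it move down by one.\<close>
  define f where "f b = (if b < j then b else b - 1)" for b
  have "inj_on f A"
  proof (rule inj_onI)
    fix x y assume "x \<in> A" "y \<in> A" and eq: "f x = f y"
    then have "x \<noteq> j" "y \<noteq> j"
      using j by auto
    then show "x = y"
      using eq unfolding f_def by (simp split: if_splits; linarith)
  qed
  moreover have "f ` A \<subseteq> B"
  proof
    fix x assume "x \<in> f ` A"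
    then obtain b where b: "b \<in> A" "x = f b"
      by blast
    show "x \<in> B"
    proof (cases "b < j")
      case True
      then show ?thesis
        using b j assms(3)[of b] by (simp add: f_def)
    next
      case False
      then have "b > j"
        using b j by (metis linorder_neqE_nat)
      then show ?thesis
        using b assms(4)[of "b - 1"] by (simp add: f_def)
    qed
  qed
  ultimately have "card A \<le> card B"
    using B by (metis card_image card_mono)
  then show ?thesis
    by simp
qed

text \<open>For \<open>i \<noteq> 0\<close> a monomial is written uniquely as
  \<open>u x_0^(t-b) x_i^b\<close> with \<open>u\<close> prime to \<open>x_0\<close> and
  \<open>x_i\<close>. Here \<open>off_axes\<close> is \<open>u\<close>, \<open>axes_degree\<close>
  is \<open>t\<close>, and \<open>place\<close> rebuilds the monomial; a fibre is given by fixed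
  \<open>u\<close> and \<open>t\<close>.\<close>

definition off_axes :: "nat \<Rightarrow> monomial \<Rightarrow> monomial" where
  "off_axes i m = m - Poly_Mapping.single 0 (Poly_Mapping.lookup m 0)
     - Poly_Mapping.single i (Poly_Mapping.lookup m i)"

definition axes_degree :: "nat \<Rightarrow> monomial \<Rightarrow> nat" where
  "axes_degree i m = Poly_Mapping.lookup m 0 + Poly_Mapping.lookup m i"

definition place :: "nat \<Rightarrow> monomial \<Rightarrow> nat \<Rightarrow> nat \<Rightarrow> monomial" where
  "place i u t b = u + Poly_Mapping.single 0 (t - b) + Poly_Mapping.single i b"

definition slots :: "nat \<Rightarrow> monomial set \<Rightarrow> monomial \<Rightarrow> nat \<Rightarrow> nat set" where
  "slots i M u t = {b. b \<le> t \<and> place i u t b \<in> M}"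

text \<open>
  For fixed \<open>u\<close> and \<open>t\<close> with \<open>u\<close> prime to \<open>x_0\<close> and \<open>x_i\<close>, the monomials \<open>u x_0^(t-b) x_i^b\<close> that
  belong to the set are replaced by equally many with the smallest exponents \<open>b\<close>.
\<close>

definition compress :: "nat \<Rightarrow> monomial set \<Rightarrow> monomial set" where
  "compress i M = {m. Poly_Mapping.lookup m i < card (slots i M (off_axes i m) (axes_degree i m))}"

context
  fixes i :: nat
  assumes i: "i \<noteq> 0"
begin

lemma lookup_off_axes:
  "Poly_Mapping.lookup (off_axes i m) j = (if j = 0 \<or> j = i then 0 else Poly_Mapping.lookup m j)"
  using i by (simp add: off_axes_def lookup_minus lookup_single when_def)

lemma lookup_place:
  assumes "Poly_Mapping.lookup u 0 = 0" "Poly_Mapping.lookup u i = 0"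
  shows "Poly_Mapping.lookup (place i u t b) j =
    (if j = 0 then t - b else if j = i then b else Poly_Mapping.lookup u j)"
  using i assms by (simp add: place_def lookup_add lookup_single when_def)

lemma place_off_axes: "place i (off_axes i m) (axes_degree i m) (Poly_Mapping.lookup m i) = m"
  using i by (intro poly_mapping_eqI)
    (simp add: place_def lookup_add lookup_single when_def lookup_off_axes axes_degree_def)

lemma off_axes_place:
  assumes "Poly_Mapping.lookup u 0 = 0" "Poly_Mapping.lookup u i = 0" "b \<le> t"
  shows "off_axes i (place i u t b) = u" "axes_degree i (place i u t b) = t"
    "Poly_Mapping.lookup (place i u t b) i = b"
proof -
  show "off_axes i (place i u t b) = u"
    by (rule poly_mapping_eqI) (use assms in \<open>simp add: lookup_off_axes lookup_place\<close>)
qed (use i assms in \<open>simp_all add: axes_degree_def lookup_place\<close>)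

lemma mon_degree_place: "b \<le> t \<Longrightarrow> mon_degree (place i u t b) = mon_degree u + t"
  by (simp add: place_def mon_degree_add)

lemma mon_degree_off_axes: "mon_degree m = mon_degree (off_axes i m) + axes_degree i m"
  using mon_degree_place[of "Poly_Mapping.lookup m i" "axes_degree i m" "off_axes i m"]
  by (simp add: place_off_axes) (simp add: axes_degree_def)

lemma slots_subset: "slots i M u t \<subseteq> {..t}"
  by (auto simp: slots_def)

lemma finite_slots: "finite (slots i M u t)"
  by (rule finite_subset[OF slots_subset]) simp

lemma card_slots_le: "card (slots i M u t) \<le> Suc t"
  using card_mono[OF _ slots_subset[of M u t]] by simp

lemma place_inj:
  assumes "Poly_Mapping.lookup u 0 = 0" "Poly_Mapping.lookup u i = 0"
  shows "inj_on (place i u t) {..t}"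
  by (rule inj_on_inverseI[of _ "\<lambda>m. Poly_Mapping.lookup m i"])
    (use assms off_axes_place(3) in simp)

text \<open>A monomial of the compressed set lies in a fibre that already meets \<open>M\<close>,
  and each fibre is finite.\<close>

lemma finite_compress:
  assumes "finite M"
  shows "finite (compress i M)"
proof (rule finite_subset)
  show "compress i M \<subseteq> (\<lambda>(n, b). place i (off_axes i n) (axes_degree i n) b) `
      (SIGMA n:M. {..axes_degree i n})"
  proof
    fix m assume m: "m \<in> compress i M"
    define u t where "u = off_axes i m" and "t = axes_degree i m"
    have "card (slots i M u t) \<noteq> 0"
      using m by (simp add: compress_def u_def t_def)
    then obtain b where b: "b \<le> t" "place i u t b \<in> M"
      by (auto simp: slots_def dest: card_ge_0_finite)
    have "off_axes i (place i u t b) = u" "axes_degree i (place i u t b) = t"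
      using b(1) by (simp_all add: off_axes_place u_def lookup_off_axes)
    moreover have "m = place i u t (Poly_Mapping.lookup m i)"
      by (simp add: u_def t_def place_off_axes)
    moreover have "Poly_Mapping.lookup m i \<le> t"
      by (simp add: t_def axes_degree_def)
    ultimately show "m \<in> (\<lambda>(n, b). place i (off_axes i n) (axes_degree i n) b) `
        (SIGMA n:M. {..axes_degree i n})"
      using b(2) by (intro image_eqI[of _ _ "(place i u t b, Poly_Mapping.lookup m i)"]) auto
  qed
qed (use assms in simp)

text \<open>Each fibre lies in a single degree, and compression preserves the number of monomials in
  every fibre.\<close>

lemma rank_function_compress:
  assumes "finite M"
  shows "rank_function (compress i M) = rank_function M"
proof
  fix d
  define key where "key m = (off_axes i m, axes_degree i m)" for m
  define A where "A N = {m \<in> N. mon_degree m = d}" for N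
  define Y where "Y = key ` (A M \<union> A (compress i M))"
  have fin: "finite (A M)" "finite (A (compress i M))"
    using assms finite_compress by (simp_all add: A_def)
  have fibre: "card {m \<in> A (compress i M). key m = y} = card {m \<in> A M. key m = y}" if y: "y \<in> Y" for y
  proof -
    obtain n where n: "y = key n" "n \<in> A M \<union> A (compress i M)"
      using y unfolding Y_def by (rule imageE)
    then have deg_n: "mon_degree n = d"
      by (auto simp: A_def)
    define u t where "u = off_axes i n" and "t = axes_degree i n"
    have u: "Poly_Mapping.lookup u 0 = 0" "Poly_Mapping.lookup u i = 0"
      by (simp_all add: u_def lookup_off_axes)
    have deg: "mon_degree m = d" if "key m = y" for m
      using that n(1) deg_n mon_degree_off_axes[of m] mon_degree_off_axes[of n] by (simp add: key_def)
    have key_iff: "key m = y \<longleftrightarrow> off_axes i m = u \<and> axes_degree i m = t" for m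
      by (simp add: n(1) key_def u_def t_def)
    have fib: "{m \<in> A N. key m = y} = place i u t ` {b. b \<le> t \<and> place i u t b \<in> N}" for N
    proof (intro equalityI subsetI)
      fix m assume m: "m \<in> {m \<in> A N. key m = y}"
      then have "m = place i u t (Poly_Mapping.lookup m i)"
        using place_off_axes[of m] by (simp add: key_iff)
      moreover have "Poly_Mapping.lookup m i \<le> t"
        using m by (auto simp: key_iff axes_degree_def)
      ultimately show "m \<in> place i u t ` {b. b \<le> t \<and> place i u t b \<in> N}"
        using m by (intro image_eqI[of _ _ "Poly_Mapping.lookup m i"]) (auto simp: A_def)
    next
      fix m assume "m \<in> place i u t ` {b. b \<le> t \<and> place i u t b \<in> N}"
      then obtain b where b: "b \<le> t" "m \<in> N" "m = place i u t b"
        by blast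
      then have "key m = y"
        using u by (simp add: key_iff off_axes_place)
      then show "m \<in> {m \<in> A N. key m = y}"
        using b deg by (simp add: A_def)
    qed
    have card_fib: "card {m \<in> A N. key m = y} = card {b. b \<le> t \<and> place i u t b \<in> N}" for N
      unfolding fib by (intro card_image inj_on_subset[OF place_inj[OF u]]) auto
    \<comment> \<open>After compression the occupied exponents form an initial segment of the same
      size; by \<open>card_slots_le\<close> that segment does not exceed \<open>t\<close>.\<close>
    have "{b. b \<le> t \<and> place i u t b \<in> compress i M} = {..<card (slots i M u t)}"
      using card_slots_le[of M u t] by (auto simp: compress_def off_axes_place u)
    then show ?thesis
      by (simp add: card_fib) (simp add: slots_def)
  qed
  have "card (A N) = (\<Sum>y\<in>Y. card {m \<in> A N. key m = y})" if "N = M \<or> N = compress i M" for N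
  proof -
    have "finite (A N)" "finite Y" "key ` A N \<subseteq> Y"
      using that fin by (auto simp: Y_def)
    from sum.group[OF this, of "\<lambda>_. 1::nat"] show ?thesis
      by simp
  qed
  then have "card (A (compress i M)) = card (A M)"
    using fibre by simp
  then show "rank_function (compress i M) d = rank_function M d"
    by (simp add: rank_function_def A_def)
qed

text \<open>Dividing by \<open>x_0\<close> or \<open>x_i\<close> keeps \<open>u\<close> and lowers
  \<open>t\<close>, so the bound for two indeterminates compares the initial segments. Dividing by
  another \<open>x_j\<close> keeps \<open>t\<close>, and the exponents occupied over
  \<open>u x_j\<close> are occupied over \<open>u\<close> as well.\<close>

lemma order_ideal_compress:
  assumes M: "finite M" "order_ideal M"
  shows "order_ideal (compress i M)"
proof (rule order_idealI)
  fix m j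
  let ?e = "\<lambda>j. Poly_Mapping.single j (1::nat)"
  define u t b where "u = off_axes i m" and "t = axes_degree i m" and "b = Poly_Mapping.lookup m i"
  assume mj: "m + ?e j \<in> compress i M"
  have bt: "b \<le> t"
    by (simp add: b_def t_def axes_degree_def)
  have "b < card (slots i M u t)"
  proof (cases "j = 0 \<or> j = i")
    case True
    then have "off_axes i (m + ?e j) = u"
      using i by (intro poly_mapping_eqI) (auto simp: u_def lookup_off_axes lookup_add lookup_single when_def)
    moreover have "axes_degree i (m + ?e j) = Suc t"
      using i True by (auto simp: t_def axes_degree_def lookup_add lookup_single when_def)
    \<comment> \<open>For \<open>j = i\<close> the product has exponent \<open>b + 1\<close>, which
      gives even more than is stated.\<close>
    ultimately have b_less: "b < card (slots i M u (Suc t))"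
      using mj by (simp add: compress_def b_def lookup_add)
    have "min (card (slots i M u (Suc t))) (Suc t) \<le> card (slots i M u t)"
    proof (rule card_shadow_ge[OF slots_subset finite_slots])
      fix c assume c: "c \<in> slots i M u (Suc t)" "c \<le> t"
      then have "place i u (Suc t) c = place i u t c + ?e 0"
        by (intro poly_mapping_eqI) (simp add: Suc_diff_le place_def lookup_add lookup_single when_def)
      then show "c \<in> slots i M u t"
        using c order_idealD[OF M(2)] by (auto simp: slots_def)
    next
      fix c assume c: "Suc c \<in> slots i M u (Suc t)"
      then have "place i u (Suc t) (Suc c) = place i u t c + ?e i"
        by (intro poly_mapping_eqI) (simp add: place_def lookup_add lookup_single when_def)
      then show "c \<in> slots i M u t"
        using c order_idealD[OF M(2)] by (auto simp: slots_def)
    qed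
    then show ?thesis
      using b_less bt by (simp add: min_def split: if_splits)
  next
    case False
    then have "off_axes i (m + ?e j) = u + ?e j"
      by (intro poly_mapping_eqI) (auto simp: u_def lookup_off_axes lookup_add lookup_single when_def)
    moreover have "axes_degree i (m + ?e j) = t" "Poly_Mapping.lookup (m + ?e j) i = b"
      using False by (auto simp: t_def b_def axes_degree_def lookup_add lookup_single when_def)
    ultimately have b_less: "b < card (slots i M (u + ?e j) t)"
      using mj by (simp add: compress_def)
    have "place i (u + ?e j) t c = place i u t c + ?e j" for c
      by (simp add: place_def ac_simps)
    then have "slots i M (u + ?e j) t \<subseteq> slots i M u t"
      using order_idealD[OF M(2)] by (auto simp: slots_def)
    then show ?thesis
      using b_less card_mono[OF finite_slots] less_le_trans by blast
  qed
  then show "m \<in> compress i M"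
    by (simp add: compress_def u_def t_def b_def)
qed

text \<open>A nonempty initial segment contains \<open>0\<close>: in the fibre of \<open>m\<close>,
  the monomial with all powers of \<open>x_i\<close> traded for powers of \<open>x_0\<close> is
  present.\<close>

lemma place_0_in_compress:
  assumes "m \<in> M"
  shows "place i (off_axes i m) (axes_degree i m) 0 \<in> compress i M"
proof -
  have "Poly_Mapping.lookup m i \<in> slots i M (off_axes i m) (axes_degree i m)"
    using assms by (simp add: slots_def place_off_axes) (simp add: axes_degree_def)
  then have "card (slots i M (off_axes i m) (axes_degree i m)) > 0"
    using finite_slots card_gt_0_iff by blast
  then show ?thesis
    by (simp add: compress_def off_axes_place lookup_off_axes)
qed

end

text \<open>Induction on the number of indeterminates other than \<open>x_0\<close> in
  \<open>m\<close>: compressing with \<open>x_0\<close> and some \<open>x_i\<close> dividing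
  \<open>m\<close> removes \<open>x_i\<close> from the tracked monomial and keeps its
  degree.\<close>

lemma order_ideal_with_pure_power:
  assumes "finite M" "order_ideal M" "m \<in> M"
  obtains M' where "finite M'" "order_ideal M'" "rank_function M' = rank_function M"
    "Poly_Mapping.single 0 (mon_degree m) \<in> M'"
  using assms
proof (induction "card (Poly_Mapping.keys m - {0})" arbitrary: M m thesis rule: less_induct)
  case less
  show ?case
  proof (cases "Poly_Mapping.keys m \<subseteq> {0}")
    case True
    then have m: "m = Poly_Mapping.single 0 (Poly_Mapping.lookup m 0)"
      by (intro poly_mapping_eqI) (auto simp: lookup_single when_def in_keys_iff)
    then have "mon_degree m = Poly_Mapping.lookup m 0"
      by (metis mon_degree_single)
    then show ?thesis
      using less.prems m by metis
  next
    case False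
    then obtain i where i: "i \<in> Poly_Mapping.keys m" "i \<noteq> 0"
      by blast
    define n where "n = place i (off_axes i m) (axes_degree i m) 0"
    have "Poly_Mapping.lookup n j = (if j = 0 then axes_degree i m else if j = i then 0 else Poly_Mapping.lookup m j)"
      for j
      using i(2) by (simp add: n_def lookup_place lookup_off_axes)
    then have "Poly_Mapping.keys n - {0} = Poly_Mapping.keys m - {0} - {i}"
      using i(2) by (auto simp: in_keys_iff split: if_splits)
    then have "Poly_Mapping.keys n - {0} \<subset> Poly_Mapping.keys m - {0}"
      using i by blast
    then have "card (Poly_Mapping.keys n - {0}) < card (Poly_Mapping.keys m - {0})"
      by (intro psubset_card_mono) simp_all
    moreover have "mon_degree n = mon_degree m"
      unfolding n_def by (simp add: mon_degree_place i mon_degree_off_axes[OF i(2), of m])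
    ultimately obtain M' where "finite M'" "order_ideal M'"
      "rank_function M' = rank_function (compress i M)" "Poly_Mapping.single 0 (mon_degree m) \<in> M'"
      using less.hyps[of n "compress i M"] less.prems(2-4) place_0_in_compress[OF i(2), of m M]
      by (metis finite_compress i(2) n_def order_ideal_compress)
    then show ?thesis
      using less.prems(1,2) by (metis i(2) rank_function_compress)
  qed
qed

section \<open>Finite O-sequences\<close>

lemma last_index_eq:
  assumes "a s \<noteq> 0" "\<And>t. t > s \<Longrightarrow> a t = 0"
  shows "last_index a = s"
  unfolding last_index_def
proof (rule the_equality)
  show "s' = s" if "a s' \<noteq> 0 \<and> (\<forall>t>s'. a t = 0)" for s'
    using assms that by (meson linorder_neqE_nat)
qed (use assms in blast)

lemma finite_O_sequence_last:
  assumes "finite_O_sequence K a"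
  shows "a (last_index a) \<noteq> 0" "\<And>t. t > last_index a \<Longrightarrow> a t = 0"
proof -
  obtain s where s: "a s \<noteq> 0" "\<forall>t>s. a t = 0"
    using assms by (auto simp: finite_O_sequence_def)
  then have "last_index a = s"
    by (simp add: last_index_eq)
  then show "a (last_index a) \<noteq> 0" "\<And>t. t > last_index a \<Longrightarrow> a t = 0"
    using s by auto
qed

context
  fixes K :: "'k::field itself"
begin

lemma finite_O_sequence_0: "finite_O_sequence K a \<Longrightarrow> a 0 = 1"
  using rank_function_0 by (auto simp: finite_O_sequence_iff)

lemma finite_O_sequence_pos:
  assumes a: "finite_O_sequence K a" and "t \<le> last_index a"
  shows "a t > 0"
  using assms(2)
proof (induction rule: inc_induct)
  case base
  then show ?case
    using finite_O_sequence_last(1)[OF a] by simp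
next
  case (step t)
  obtain M where "finite M" "order_ideal M" "a = rank_function M"
    using a by (auto simp: finite_O_sequence_iff)
  then show ?case
    using step.IH rank_function_Suc_nonzero[of M t] by simp
qed

lemma finite_O_sequence_le_1:
  assumes "finite_O_sequence K a" "a t = 1" "t > 0"
  shows "a (Suc t) \<le> 1"
proof -
  obtain M where "finite M" "order_ideal M" "a = rank_function M"
    using assms(1) by (auto simp: finite_O_sequence_iff)
  then show ?thesis
    using rank_function_Suc_le_1[of M t] assms(2,3) by simp
qed

text \<open>A monomial of top degree has no proper multiple in \<open>M\<close>, so any of them may
  be removed. The value \<open>c = 0\<close> is allowed and drops the last entry; a positive last
  index keeps the monomial \<open>0\<close> in the set.\<close>

lemma finite_O_sequence_lower_last:
  assumes a: "finite_O_sequence K a" and s: "last_index a > 0" and c: "c \<le> a (last_index a)"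
  shows "finite_O_sequence K (a(last_index a := c))"
proof -
  define s where "s = last_index a"
  obtain M where M: "finite M" "M \<noteq> {}" "order_ideal M" and a_eq: "a = rank_function M"
    using a by (auto simp: finite_O_sequence_iff)
  have deg_le: "mon_degree m \<le> s" if "m \<in> M" for m
    using finite_O_sequence_last(2)[OF a, of "mon_degree m"] that M(1)
    by (force simp: s_def a_eq rank_function_eq_0_iff not_less[symmetric])
  have "a s - c \<le> card {m \<in> M. mon_degree m = s}"
    by (simp add: a_eq rank_function_def)
  then obtain C where C: "C \<subseteq> {m \<in> M. mon_degree m = s}" "card C = a s - c"
    by (meson obtain_subset_with_card_n)
  then have finC: "finite C"
    using M(1) finite_subset by fastforce
  have "order_ideal (M - C)"
    unfolding order_ideal_def
  proof (intro allI impI)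
    fix m n assume mn: "m + n \<in> M - C"
    then have "m \<in> M"
      using order_idealD[OF M(3)] by blast
    moreover have "m \<notin> C"
    proof
      assume "m \<in> C"
      then have "mon_degree (m + n) = s + mon_degree n"
        using C(1) by (auto simp: mon_degree_add)
      then have "n = 0"
        using deg_le[of "m + n"] mn by simp
      then show False
        using mn \<open>m \<in> C\<close> by simp
    qed
    ultimately show "m \<in> M - C"
      by simp
  qed
  moreover have "0 \<in> M - C"
    using order_ideal_zero[OF M(3,2)] C(1) s by (auto simp: s_def)
  moreover have "a(s := c) = rank_function (M - C)"
  proof
    fix t
    show "(a(s := c)) t = rank_function (M - C) t"
    proof (cases "t = s")
      case True
      have "{m \<in> M - C. mon_degree m = s} = {m \<in> M. mon_degree m = s} - C"
        by auto
      then have "rank_function (M - C) s = a s - (a s - c)"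
        using C finC by (simp add: rank_function_def a_eq card_Diff_subset)
      then show ?thesis
        using True c by (simp add: s_def)
    next
      case False
      then have "{m \<in> M - C. mon_degree m = t} = {m \<in> M. mon_degree m = t}"
        using C(1) by auto
      then show ?thesis
        using False by (simp add: rank_function_def a_eq)
    qed
  qed
  ultimately show ?thesis
    unfolding finite_O_sequence_iff s_def[symmetric] using M(1) by (intro exI[of _ "M - C"]) auto
qed

lemma finite_O_sequence_append_1:
  assumes a: "finite_O_sequence K a"
  shows "finite_O_sequence K (a(Suc (last_index a) := 1))"
proof -
  define s where "s = last_index a"
  obtain N where N: "finite N" "order_ideal N" and aN: "a = rank_function N"
    using a by (auto simp: finite_O_sequence_iff)
  then obtain m where "m \<in> N" "mon_degree m = s"
    using finite_O_sequence_last(1)[OF a] by (auto simp: s_def rank_function_eq_0_iff)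
  \<comment> \<open>The set realizing \<open>a\<close> is exchanged for one containing
    \<open>x_0^s\<close>, the only divisor of degree \<open>s\<close> of the new monomial
    \<open>x_0^(s+1)\<close>.\<close>
  with N obtain M where M: "finite M" "order_ideal M" "Poly_Mapping.single 0 s \<in> M"
    and a_eq: "a = rank_function M"
    unfolding aN by (metis order_ideal_with_pure_power)
  define x where "x = Poly_Mapping.single (0::nat) (Suc s)"
  have deg_le: "mon_degree m \<le> s" if "m \<in> M" for m
    using finite_O_sequence_last(2)[OF a, of "mon_degree m"] that M(1)
    by (force simp: s_def a_eq rank_function_eq_0_iff not_less[symmetric])
  have "order_ideal (insert x M)"
  proof (rule order_idealI)
    fix m j assume mj: "m + Poly_Mapping.single j 1 \<in> insert x M"
    show "m \<in> insert x M"
    proof (cases "m + Poly_Mapping.single j 1 = x")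
      case True
      then have "Poly_Mapping.keys (m + Poly_Mapping.single j 1) = {0}"
        by (simp add: x_def)
      then have "j = 0"
        unfolding keys_add_monomial by simp
      then have "m + Poly_Mapping.single 0 1 = Poly_Mapping.single 0 s + Poly_Mapping.single 0 1"
        using True by (simp add: x_def flip: single_add)
      then show ?thesis
        using M(3) by simp
    next
      case False
      then show ?thesis
        using mj order_idealD[OF M(2)] by blast
    qed
  qed
  moreover have "a(Suc s := 1) = rank_function (insert x M)"
  proof
    fix t
    show "(a(Suc s := 1)) t = rank_function (insert x M) t"
    proof (cases "t = Suc s")
      case True
      then have "{m \<in> insert x M. mon_degree m = t} = {x}"
        using deg_le by (fastforce simp: x_def)
      then show ?thesis
        using True by (simp add: rank_function_def)
    next
      case False
      then have "{m \<in> insert x M. mon_degree m = t} = {m \<in> M. mon_degree m = t}"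
        by (auto simp: x_def)
      then show ?thesis
        using False by (simp add: rank_function_def a_eq)
    qed
  qed
  ultimately show ?thesis
    unfolding finite_O_sequence_iff s_def[symmetric] using M(1) by (intro exI[of _ "insert x M"]) auto
qed

text \<open>Realized by the constant monomial and \<open>n\<close> indeterminates; this is the
  witness for the positivity of \<open>A_num\<close>.\<close>

lemma finite_O_sequence_linear:
  assumes "n > 0"
  shows "finite_O_sequence K (\<lambda>t. if t = 0 then 1 else if t = 1 then n else 0)"
proof -
  define X where "X = (\<lambda>i. Poly_Mapping.single i (1::nat)) ` {..<n}"
  have "inj_on (\<lambda>i::nat. Poly_Mapping.single i (1::nat)) {..<n}"
    by (rule inj_onI) (metis keys_single singleton_inject zero_neq_one)
  then have "card X = n"
    by (simp add: X_def card_image)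
  have deg: "mon_degree x = 1" if "x \<in> X" for x
    using that by (auto simp: X_def)
  have "order_ideal (insert 0 X)"
    unfolding order_ideal_def
  proof (intro allI impI)
    fix k l assume kl: "k + l \<in> insert 0 X"
    show "k \<in> insert 0 X"
    proof (cases "l = 0")
      case False
      then have "mon_degree l \<noteq> 0"
        by simp
      moreover have "mon_degree k + mon_degree l \<le> 1"
        using kl deg by (auto simp flip: mon_degree_add)
      ultimately have "mon_degree k = 0"
        by linarith
      then show ?thesis
        by simp
    qed (use kl in simp)
  qed
  moreover have "(\<lambda>t. if t = 0 then 1 else if t = 1 then n else 0) = rank_function (insert 0 X)"
  proof
    fix t
    have "{m \<in> insert 0 X. mon_degree m = t} = (if t = 0 then {0} else if t = 1 then X else {})"
      by (auto simp: deg)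
    then show "(if t = 0 then 1 else if t = 1 then n else 0) = rank_function (insert 0 X) t"
      using \<open>card X = n\<close> by (simp add: rank_function_def)
  qed
  ultimately show ?thesis
    unfolding finite_O_sequence_iff by (intro exI[of _ "insert 0 X"]) (simp add: X_def)
qed

section \<open>Last index and multiplicity under changes at the end of a sequence\<close>

lemma seq_multiplicity_eq_sum:
  assumes "finite_O_sequence K a" "last_index a \<le> n"
  shows "seq_multiplicity a = (\<Sum>t\<le>n. a t)"
  unfolding seq_multiplicity_def
  by (rule sum.mono_neutral_left) (use assms finite_O_sequence_last(2)[OF assms(1)] in auto)

lemma last_index_update:
  assumes "finite_O_sequence K a" "last_index a \<le> s" "c > 0"
  shows "last_index (a(s := c)) = s"
  by (rule last_index_eq) (use assms(2,3) finite_O_sequence_last(2)[OF assms(1)] in auto)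

text \<open>Covers both changing the last value and appending a new one, where
  \<open>a s = 0\<close>. The additive form avoids truncated subtraction.\<close>

lemma seq_multiplicity_update:
  assumes a: "finite_O_sequence K a" and s: "last_index a \<le> s" and c: "c > 0"
  shows "seq_multiplicity (a(s := c)) + a s = seq_multiplicity a + c"
proof -
  have "seq_multiplicity (a(s := c)) = (\<Sum>t\<le>s. (a(s := c)) t)"
    by (simp add: seq_multiplicity_def last_index_update[OF assms])
  moreover have "seq_multiplicity a = (\<Sum>t\<le>s. a t)"
    by (rule seq_multiplicity_eq_sum[OF a s])
  ultimately show ?thesis
    by (cases s) simp_all
qed

text \<open>The new last index is exactly \<open>s\<close> because an \<open>O\<close>-sequence has
  no zero before its last index.\<close>

lemma finite_O_sequence_truncate:
  assumes a: "finite_O_sequence K a" and s: "last_index a = Suc s"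
  shows "finite_O_sequence K (a(Suc s := 0))" "last_index (a(Suc s := 0)) = s"
    "seq_multiplicity (a(Suc s := 0)) + a (Suc s) = seq_multiplicity a"
proof -
  show fin: "finite_O_sequence K (a(Suc s := 0))"
    using finite_O_sequence_lower_last[OF a, of 0] s by simp
  show last: "last_index (a(Suc s := 0)) = s"
  proof (rule last_index_eq)
    show "(a(Suc s := 0)) t = 0" if "t > s" for t
      using that finite_O_sequence_last(2)[OF a, of t] s by simp
  qed (use finite_O_sequence_pos[OF a, of s] s in simp)
  show "seq_multiplicity (a(Suc s := 0)) + a (Suc s) = seq_multiplicity a"
    by (simp add: seq_multiplicity_def last s)
qed

section \<open>Recurrences for the numbers of sequences of given multiplicity\<close>

abbreviation "O_set d \<equiv> {a. finite_O_sequence K a \<and> seq_multiplicity a = d}"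
abbreviation "A_set d \<equiv> {a. finite_O_sequence K a \<and> seq_multiplicity a = d \<and> a (last_index a) > 1}"

text \<open>All entries up to the last index are at least \<open>1\<close>, so both the last index
  and the entries are bounded by \<open>d\<close>.\<close>

lemma finite_O_set: "finite (O_set d)"
proof (rule finite_subset)
  show "O_set d \<subseteq> {a. \<forall>t. (t \<in> {..d} \<longrightarrow> a t \<in> {..d}) \<and> (t \<notin> {..d} \<longrightarrow> a t = 0)}"
  proof
    fix a assume "a \<in> O_set d"
    then have a: "finite_O_sequence K a" and d: "(\<Sum>t\<le>last_index a. a t) = d"
      by (auto simp: seq_multiplicity_def)
    have "(\<Sum>t\<le>last_index a. 1) \<le> (\<Sum>t\<le>last_index a. a t)"
      using finite_O_sequence_pos[OF a] by (intro sum_mono) (simp add: Suc_le_eq)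
    then have last: "last_index a < d"
      using d by simp
    have "a t \<le> d" for t
    proof (cases "t \<le> last_index a")
      case True
      then show ?thesis
        using member_le_sum[of t "{..last_index a}" a] d by simp
    next
      case False
      then show ?thesis
        using finite_O_sequence_last(2)[OF a, of t] by simp
    qed
    then show "a \<in> {a. \<forall>t. (t \<in> {..d} \<longrightarrow> a t \<in> {..d}) \<and> (t \<notin> {..d} \<longrightarrow> a t = 0)}"
      using finite_O_sequence_last(2)[OF a] last by auto
  qed
qed (intro finite_set_of_finite_funs finite_atMost)

lemma finite_A_set: "finite (A_set d)"
  by (rule finite_subset[OF _ finite_O_set[of d]]) auto

lemma seq_multiplicity_last_0:
  "finite_O_sequence K a \<Longrightarrow> last_index a = 0 \<Longrightarrow> seq_multiplicity a = 1"
  by (simp add: seq_multiplicity_def finite_O_sequence_0)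

text \<open>Appending \<open>1\<close> is a bijection onto the sequences with last value
  \<open>1\<close>. The sequence \<open>(1)\<close> is not reached; \<open>d \<ge> 1\<close>
  excludes it through its multiplicity.\<close>

lemma O_num_Suc:
  assumes "d \<ge> 1"
  shows "O_num K (Suc d) = O_num K d + A_num K (Suc d)"
proof -
  define B where "B = {a \<in> O_set (Suc d). a (last_index a) = 1}"
  let ?f = "\<lambda>a. a(Suc (last_index a) := 1)"
  have f: "finite_O_sequence K (?f a)" "last_index (?f a) = Suc (last_index a)"
    "seq_multiplicity (?f a) = Suc (seq_multiplicity a)" "(?f a)(Suc (last_index a) := 0) = a"
    if "finite_O_sequence K a" for a
    using finite_O_sequence_append_1[OF that] last_index_update[OF that, of "Suc (last_index a)" 1]
      seq_multiplicity_update[OF that, of "Suc (last_index a)" 1] finite_O_sequence_last(2)[OF that]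
    by auto
  have "bij_betw ?f (O_set d) B"
    unfolding bij_betw_def
  proof
    show "inj_on ?f (O_set d)"
      by (rule inj_on_inverseI[of _ "\<lambda>b. b(last_index b := 0)"]) (use f in auto)
    show "?f ` O_set d = B"
    proof (intro equalityI subsetI)
      fix b assume "b \<in> ?f ` O_set d"
      then show "b \<in> B"
        using f by (auto simp: B_def)
    next
      fix b assume "b \<in> B"
      then have b: "finite_O_sequence K b" "seq_multiplicity b = Suc d" "b (last_index b) = 1"
        by (auto simp: B_def)
      then obtain s where s: "last_index b = Suc s"
        using seq_multiplicity_last_0[OF b(1)] assms by (cases "last_index b") auto
      have "b = ?f (b(Suc s := 0))"
        using finite_O_sequence_truncate(2)[OF b(1) s] b(3) s by (simp add: fun_eq_iff)
      moreover have "b(Suc s := 0) \<in> O_set d"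
        using finite_O_sequence_truncate[OF b(1) s] b(2,3) s by simp
      ultimately show "b \<in> ?f ` O_set d"
        by blast
    qed
  qed
  then have "card B = O_num K d"
    by (simp add: O_num_def bij_betw_same_card)
  moreover have "O_set (Suc d) = B \<union> A_set (Suc d)"
    using finite_O_sequence_last(1) by (fastforce simp: B_def)
  moreover have "B \<inter> A_set (Suc d) = {}"
    by (auto simp: B_def)
  ultimately show ?thesis
    using finite_O_set[of "Suc d"] finite_A_set[of "Suc d"]
    by (simp add: O_num_def A_num_def card_Un_disjoint)
qed

text \<open>The lowered value is still positive, so the last index stays and the operation can be
  undone. The last index is positive since the value in degree \<open>0\<close> is
  \<open>1\<close>.\<close>

lemma decrement_last:
  assumes a: "finite_O_sequence K a" "a (last_index a) > 1"
  defines "b \<equiv> a(last_index a := a (last_index a) - 1)"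
  shows "finite_O_sequence K b" "last_index b = last_index a"
    "Suc (seq_multiplicity b) = seq_multiplicity a"
proof -
  have "last_index a > 0"
    using finite_O_sequence_0[OF a(1)] a(2) by (cases "last_index a") auto
  then show "finite_O_sequence K b"
    unfolding b_def by (rule finite_O_sequence_lower_last[OF a(1)]) simp
  show "last_index b = last_index a"
    unfolding b_def by (rule last_index_update) (use a in auto)
  show "Suc (seq_multiplicity b) = seq_multiplicity a"
    using seq_multiplicity_update[OF a(1), of "last_index a" "a (last_index a) - 1"] a(2)
    by (simp add: b_def)
qed

lemma inj_on_decrement_last:
  "inj_on (\<lambda>a. a(last_index a := a (last_index a) - 1)) (A_set d)"
  by (rule inj_on_inverseI[of _ "\<lambda>b. b(last_index b := Suc (b (last_index b)))"])
    (use decrement_last(2) in auto)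

lemma A_num_le_O_num: "A_num K (Suc d) \<le> O_num K d"
  unfolding A_num_def O_num_def
  by (rule card_inj_on_le[OF inj_on_decrement_last _ finite_O_set]) (use decrement_last in force)

text \<open>Last values above \<open>2\<close> are lowered by \<open>1\<close> and remain above
  \<open>1\<close>; last values equal to \<open>2\<close> are dropped, and the value before them is
  above \<open>1\<close>. Both maps are injective.\<close>

lemma A_num_le_add:
  assumes "d \<ge> 2"
  shows "A_num K (Suc (Suc d)) \<le> A_num K (Suc d) + A_num K d"
proof -
  define P where "P = {a \<in> A_set (Suc (Suc d)). a (last_index a) > 2}"
  define Q where "Q = {a \<in> A_set (Suc (Suc d)). a (last_index a) = 2}"
  have "card P \<le> card (A_set (Suc d))"
  proof (rule card_inj_on_le[OF _ _ finite_A_set])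
    show "inj_on (\<lambda>a. a(last_index a := a (last_index a) - 1)) P"
      by (rule inj_on_subset[OF inj_on_decrement_last[of "Suc (Suc d)"]]) (auto simp: P_def)
    show "(\<lambda>a. a(last_index a := a (last_index a) - 1)) ` P \<subseteq> A_set (Suc d)"
      using decrement_last by (fastforce simp: P_def)
  qed
  moreover have "card Q \<le> card (A_set d)"
  proof (rule card_inj_on_le[OF _ _ finite_A_set])
    have Q: "finite_O_sequence K a \<and> seq_multiplicity a = Suc (Suc d) \<and>
        (\<exists>s. last_index a = Suc (Suc s)) \<and> a (last_index a) = 2 \<and> a (last_index a - 1) > 1" if "a \<in> Q" for a
    proof -
      have a: "finite_O_sequence K a" "seq_multiplicity a = Suc (Suc d)" "a (last_index a) = 2"
        using that by (auto simp: Q_def)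
      have "last_index a \<noteq> 0"
        using a(3) finite_O_sequence_0[OF a(1)] by (metis numeral_eq_one_iff semiring_norm(85))
      \<comment> \<open>The sequence \<open>(1, 2)\<close> has multiplicity \<open>3\<close>, while
        here the multiplicity is at least \<open>4\<close>.\<close>
      moreover have "last_index a \<noteq> 1"
      proof
        assume "last_index a = 1"
        then have "seq_multiplicity a = a 0 + a 1"
          by (simp add: seq_multiplicity_def)
        then show False
          using a finite_O_sequence_0[OF a(1)] assms \<open>last_index a = 1\<close> by simp
      qed
      ultimately obtain s where s: "last_index a = Suc (Suc s)"
        by (metis One_nat_def not0_implies_Suc)
      \<comment> \<open>A value \<open>1\<close> in positive degree could not be followed by
        \<open>2\<close>.\<close>
      have "a (Suc s) \<noteq> 1"
        using finite_O_sequence_le_1[OF a(1), of "Suc s"] a(3) s by auto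
      moreover have "a (Suc s) > 0"
        by (rule finite_O_sequence_pos[OF a(1)]) (simp add: s)
      ultimately show ?thesis
        using a s by simp
    qed
    show "inj_on (\<lambda>a. a(last_index a := 0)) Q"
    proof (rule inj_on_inverseI[of _ "\<lambda>b. b(Suc (last_index b) := 2)"])
      fix a assume "a \<in> Q"
      then obtain s where "finite_O_sequence K a" "last_index a = Suc (Suc s)" "a (last_index a) = 2"
        using Q by blast
      then show "(a(last_index a := 0))(Suc (last_index (a(last_index a := 0))) := 2) = a"
        using finite_O_sequence_truncate(2)[of a "Suc s"] by (simp add: fun_eq_iff)
    qed
    show "(\<lambda>a. a(last_index a := 0)) ` Q \<subseteq> A_set d"
    proof (intro image_subsetI)
      fix a assume "a \<in> Q"
      then obtain s where a: "finite_O_sequence K a" "last_index a = Suc (Suc s)" "a (last_index a) = 2"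
        "seq_multiplicity a = Suc (Suc d)" "a (last_index a - 1) > 1"
        using Q by blast
      then show "a(last_index a := 0) \<in> A_set d"
        using finite_O_sequence_truncate[OF a(1,2)] by simp
    qed
  qed
  moreover have "card (P \<union> Q) \<le> card P + card Q"
    by (rule card_Un_le)
  moreover have "A_set (Suc (Suc d)) = P \<union> Q"
    by (auto simp: P_def Q_def)
  ultimately show ?thesis
    unfolding A_num_def by simp
qed

lemma A_num_pos:
  assumes "d \<ge> 3"
  shows "A_num K d > 0"
proof -
  let ?a = "\<lambda>t. if t = 0 then 1 else if t = 1 then d - 1 else (0::nat)"
  have last: "last_index ?a = 1"
    by (rule last_index_eq) (use assms in auto)
  then have "?a \<in> A_set d"
    using finite_O_sequence_linear[of "d - 1"] assms by (simp add: seq_multiplicity_def)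
  then show ?thesis
    unfolding A_num_def using finite_A_set[of d] card_gt_0_iff by blast
qed

lemma O_num_1: "O_num K 1 = 1"
proof -
  have "O_set 1 = {\<lambda>t. if t = 0 then 1 else 0}"
  proof (intro equalityI subsetI)
    fix a assume "a \<in> O_set 1"
    then have a: "finite_O_sequence K a" "seq_multiplicity a = 1"
      by auto
    have "last_index a = 0"
    proof (rule ccontr)
      assume "last_index a \<noteq> 0"
      then obtain s where s: "last_index a = Suc s"
        by (cases "last_index a") auto
      have "a (Suc s) > 0"
        by (rule finite_O_sequence_pos[OF a(1)]) (simp add: s)
      moreover have "(\<Sum>t\<le>s. a t) \<ge> a 0"
        by (rule member_le_sum) auto
      ultimately show False
        using a(2) finite_O_sequence_0[OF a(1)] by (simp add: seq_multiplicity_def s)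
    qed
    then show "a \<in> {\<lambda>t. if t = 0 then 1 else 0}"
      using finite_O_sequence_0[OF a(1)] finite_O_sequence_last(2)[OF a(1)] by (auto simp: fun_eq_iff)
  next
    fix a :: "nat \<Rightarrow> nat" assume a: "a \<in> {\<lambda>t. if t = 0 then 1 else 0}"
    have last: "last_index a = 0"
      by (rule last_index_eq) (use a in auto)
    have "order_ideal {0}"
      by (rule order_idealI) (auto simp: poly_mapping_eq_iff fun_eq_iff lookup_add lookup_single when_def)
    moreover have "a = rank_function {0}"
      using a by (auto simp: fun_eq_iff rank_function_def)
    ultimately have "finite_O_sequence K a"
      unfolding finite_O_sequence_iff by (intro exI[of _ "{0}"]) simp
    then show "a \<in> O_set 1"
      using a last by (simp add: seq_multiplicity_def)
  qed
  then show ?thesis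
    by (simp add: O_num_def)
qed

end

section \<open>Growth\<close>

context
  fixes K :: "'k::field itself"
begin

lemma O_num_pos: "d \<ge> 1 \<Longrightarrow> O_num K d > 0"
proof (induction d rule: dec_induct)
  case base
  then show ?case
    using O_num_1[of K] by simp
next
  case (step d)
  then show ?case
    using O_num_Suc[of d K] by simp
qed

text \<open>\<open>O_num_Suc\<close> divided by a positive \<open>O_num K (d - 1)\<close>; claims
  about one ratio thereby become claims about the other.\<close>

lemma O_ratio_eq:
  assumes "d \<ge> 2"
  shows "O_ratio K d = 1 + A_ratio K d"
proof -
  obtain e where e: "d = Suc e" "e \<ge> 1"
    using assms by (cases d) auto
  then show ?thesis
    using O_num_Suc[of e K] O_num_pos[of e] by (simp add: O_ratio_def A_ratio_def field_simps)
qed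

lemma A_ratio_le_1: "A_ratio K (Suc d) \<le> 1"
  using A_num_le_O_num[of K d] by (simp add: A_ratio_def divide_le_eq)

lemma A_ratio_pos: "d \<ge> 3 \<Longrightarrow> A_ratio K d > 0"
  using A_num_pos[of d K] O_num_pos[of "d - 1"] by (simp add: A_ratio_def)

text \<open>Doubling at each step, started at \<open>O_2 = 1\<close>.\<close>

lemma O_num_le_power: "d \<ge> 2 \<Longrightarrow> O_num K d \<le> 2 ^ (d - 2)"
proof (induction d rule: dec_induct)
  case base
  \<comment> \<open>A last value above \<open>1\<close> together with the initial \<open>1\<close>
    already gives multiplicity at least \<open>3\<close>; hence \<open>O_2 = O_1\<close>.\<close>
  have "A_set K 2 = {}"
  proof -
    have False if "a \<in> A_set K 2" for a
    proof -
      have a: "finite_O_sequence K a" "seq_multiplicity a = 2" "a (last_index a) > 1"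
        using that by auto
      have "last_index a \<noteq> 0"
        using finite_O_sequence_0[OF a(1)] a(3) by (cases "last_index a") auto
      then have "a 0 \<le> (\<Sum>t<last_index a. a t)"
        by (intro member_le_sum) auto
      moreover have "seq_multiplicity a = (\<Sum>t<last_index a. a t) + a (last_index a)"
        by (simp add: seq_multiplicity_def flip: lessThan_Suc_atMost)
      ultimately show False
        using finite_O_sequence_0[OF a(1)] a(2,3) by simp
    qed
    then show ?thesis
      by blast
  qed
  then have "A_num K 2 = 0"
    by (simp only: A_num_def card.empty)
  then show ?case
    using O_num_Suc[of 1 K] O_num_1[of K] by (simp add: numeral_2_eq_2)
next
  case (step d)
  have "O_num K (Suc d) \<le> 2 * O_num K d"
    using O_num_Suc[of d K] A_num_le_O_num[of K d] step.hyps by simp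
  also have "\<dots> \<le> 2 * 2 ^ (d - 2)"
    using step.IH by simp
  also have "\<dots> = 2 ^ (Suc d - 2)"
    by (simp only: Suc_diff_le[OF step.hyps(1)] power_Suc)
  finally show ?case .
qed

lemma O_num_mono:
  assumes "1 \<le> c" "c \<le> d"
  shows "O_num K c \<le> O_num K d"
  using assms(2)
proof (induction d rule: dec_induct)
  case (step d)
  then show ?case
    using O_num_Suc[of d K] assms(1) by simp
qed simp

text \<open>The recurrence is divided by \<open>O_(d-1)\<close>, whose two occurrences are then
  replaced by the smaller \<open>O_(d-2)\<close> and \<open>O_(d-3)\<close>; the latter is positive
  since \<open>d \<ge> 4\<close>.\<close>

lemma A_ratio_le_add:
  assumes "d \<ge> 4"
  shows "A_ratio K d \<le> A_ratio K (d - 1) + A_ratio K (d - 2)"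
proof -
  obtain e where e: "d = Suc (Suc e)" "e \<ge> 2"
    using assms by (intro that[of "d - 2"]) auto
  have "A_ratio K d \<le> (real (A_num K (Suc e)) + real (A_num K e)) / real (O_num K (Suc e))"
    using A_num_le_add[OF e(2), of K] by (simp add: A_ratio_def e(1) divide_right_mono flip: of_nat_add)
  also have "\<dots> \<le> real (A_num K (Suc e)) / real (O_num K e) + real (A_num K e) / real (O_num K (e - 1))"
    unfolding add_divide_distrib
    using O_num_pos[of e] O_num_pos[of "e - 1"] O_num_mono[of e "Suc e"] O_num_mono[of "e - 1" "Suc e"] e(2)
    by (intro add_mono divide_left_mono) simp_all
  finally show ?thesis
    using e by (simp add: A_ratio_def)
qed

lemma O_ratio_tendsto_iff: "O_ratio K \<longlonglongrightarrow> b \<longleftrightarrow> A_ratio K \<longlonglongrightarrow> b - 1"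
proof -
  have "\<forall>\<^sub>F d in sequentially. O_ratio K d = 1 + A_ratio K d"
    using O_ratio_eq by (auto simp: eventually_sequentially)
  then have "O_ratio K \<longlonglongrightarrow> b \<longleftrightarrow> (\<lambda>d. 1 + A_ratio K d) \<longlonglongrightarrow> 1 + (b - 1)"
    using tendsto_cong by simp
  also have "\<dots> \<longleftrightarrow> A_ratio K \<longlonglongrightarrow> b - 1"
    by (rule tendsto_add_const_iff)
  finally show ?thesis .
qed

lemma golden_ratio_bound:
  fixes b :: real
  assumes "b\<^sup>2 \<le> b + 1"
  shows "b \<le> (1 + sqrt 5) / 2"
proof -
  have "(2 * b - 1)\<^sup>2 \<le> 5"
    using assms by (simp add: power2_eq_square algebra_simps)
  then have "2 * b - 1 \<le> sqrt 5"
    by (rule real_le_rsqrt)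
  then show ?thesis
    by simp
qed

text \<open>Makes the bounds for \<open>b\<close> and for \<open>b - 1\<close> the same
  inequality.\<close>

lemma inverse_golden_ratio: "inverse ((1 + sqrt 5) / 2) = (1 + sqrt 5) / 2 - (1::real)"
  by (rule inverse_unique) (simp add: field_simps)

text \<open>
  The recursion \<open>A_d \<le> A_(d-1) + A_(d-2)\<close>, divided by \<open>O_(d-2)\<close>, becomes
  \<open>l b \<le> l + l / b\<close> in the limit, where \<open>l = b - 1\<close>.
\<close>

lemma O_ratio_limit_le:
  assumes b: "O_ratio K \<longlonglongrightarrow> b"
  shows "b \<le> (1 + sqrt 5) / 2"
proof (cases "b \<le> 1")
  case True
  then show ?thesis
    by (rule order.trans) simp
next
  case False
  define l where "l = b - 1"
  have l: "A_ratio K \<longlonglongrightarrow> l" "l > 0"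
    using b False by (simp_all add: O_ratio_tendsto_iff l_def)
  \<comment> \<open>The factor \<open>O_ratio K (d + 3)\<close> turns the denominator
    \<open>O_(d+3)\<close> into \<open>O_(d+2)\<close>. The shifts keep every denominator positive
    and the recurrence applicable for all \<open>d\<close>.\<close>
  have ineq: "A_ratio K (d + 4) * O_ratio K (d + 3) \<le> A_ratio K (d + 3) + A_ratio K (d + 2) / O_ratio K (d + 2)" for d
  proof -
    have pos: "O_num K (Suc d) > 0" "O_num K (d + 2) > 0" "O_num K (d + 3) > 0"
      by (simp_all add: O_num_pos)
    have "A_ratio K (d + 4) * O_ratio K (d + 3) = real (A_num K (d + 4)) / real (O_num K (d + 2))"
      using pos by (simp add: A_ratio_def O_ratio_def add.commute[of d])
    also have "\<dots> \<le> (real (A_num K (d + 3)) + real (A_num K (d + 2))) / real (O_num K (d + 2))"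
      using A_num_le_add[of "d + 2" K] by (intro divide_right_mono) (simp_all add: eval_nat_numeral)
    also have "\<dots> = A_ratio K (d + 3) + A_ratio K (d + 2) / O_ratio K (d + 2)"
      using pos by (simp add: A_ratio_def O_ratio_def add_divide_distrib)
    finally show ?thesis .
  qed
  have "l * b \<le> l + l / b"
  proof (rule LIMSEQ_le)
    show "(\<lambda>d. A_ratio K (d + 4) * O_ratio K (d + 3)) \<longlonglongrightarrow> l * b"
      by (intro tendsto_mult LIMSEQ_ignore_initial_segment l b)
    show "(\<lambda>d. A_ratio K (d + 3) + A_ratio K (d + 2) / O_ratio K (d + 2)) \<longlonglongrightarrow> l + l / b"
      by (intro tendsto_add tendsto_divide LIMSEQ_ignore_initial_segment l b) (use False in simp)
  qed (use ineq in blast)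
  \<comment> \<open>Multiplication by \<open>b > 0\<close>; afterwards \<open>l > 0\<close>
    cancels.\<close>
  then have "l * b\<^sup>2 \<le> l * (b + 1)"
    using False by (simp add: field_simps power2_eq_square)
  then have "b\<^sup>2 \<le> b + 1"
    using l(2) by simp
  then show ?thesis
    by (rule golden_ratio_bound)
qed

end

theorem proposition2p5:
  fixes K :: "'k::field itself"
  shows "(\<forall>d\<ge>3. 1 < O_ratio K d \<and> O_ratio K d \<le> 2 \<and> O_num K d \<le> 2 ^ (d - 2)) \<and>
    (\<forall>b::real. O_ratio K \<longlonglongrightarrow> b \<longleftrightarrow> A_ratio K \<longlonglongrightarrow> b - 1) \<and>
    (\<forall>b::real. O_ratio K \<longlonglongrightarrow> b \<longrightarrow>
       b \<le> (1 + sqrt 5) / 2 \<and>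
       (\<exists>l::real. A_ratio K \<longlonglongrightarrow> l \<and>
          l \<le> inverse ((1 + sqrt 5) / 2) \<and>
          (b \<le> (1 + sqrt 5) / 2 \<longleftrightarrow> l \<le> inverse ((1 + sqrt 5) / 2)))) \<and>
    (\<forall>d\<ge>4. A_ratio K d \<le> A_ratio K (d - 1) + A_ratio K (d - 2) \<and>
       O_ratio K d \<le> O_ratio K (d - 1) + O_ratio K (d - 2))"
proof (intro conjI allI impI)
  fix d :: nat assume d: "d \<ge> 3"
  show "1 < O_ratio K d"
    using d A_ratio_pos[of d K] by (simp add: O_ratio_eq)
  show "O_ratio K d \<le> 2"
    using d A_ratio_le_1[of K "d - 1"] by (simp add: O_ratio_eq)
  show "O_num K d \<le> 2 ^ (d - 2)"
    using d by (intro O_num_le_power) simp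
next
  fix b :: real
  show "O_ratio K \<longlonglongrightarrow> b \<longleftrightarrow> A_ratio K \<longlonglongrightarrow> b - 1"
    by (rule O_ratio_tendsto_iff)
next
  fix b :: real assume b: "O_ratio K \<longlonglongrightarrow> b"
  show "b \<le> (1 + sqrt 5) / 2"
    by (rule O_ratio_limit_le[OF b])
  then show "\<exists>l::real. A_ratio K \<longlonglongrightarrow> l \<and> l \<le> inverse ((1 + sqrt 5) / 2) \<and>
      (b \<le> (1 + sqrt 5) / 2 \<longleftrightarrow> l \<le> inverse ((1 + sqrt 5) / 2))"
    using b unfolding inverse_golden_ratio
    by (intro exI[of _ "b - 1"]) (simp add: O_ratio_tendsto_iff)
next
  fix d :: nat assume d: "d \<ge> 4"
  show A: "A_ratio K d \<le> A_ratio K (d - 1) + A_ratio K (d - 2)"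
    by (rule A_ratio_le_add[OF d])
  \<comment> \<open>In terms of \<open>A_ratio\<close> there is a \<open>1\<close> on the left and a
    \<open>2\<close> on the right, so the inequality follows from \<open>A\<close> with room to
    spare.\<close>
  show "O_ratio K d \<le> O_ratio K (d - 1) + O_ratio K (d - 2)"
    using A d by (simp add: O_ratio_eq)
qed

end
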